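(* There exist positive absolute constants $c_5,c_6$ and a positive absolute constant $c$ such that the following holds. (1) Given $\epsilon\in(0,1]$, there is a weight $w$ with $1\le w\le 1+\epsilon$ and a subsequence $\{k_n\}\subset\mathbb{N}$ such that $$\|\phi_{k_n}(e^{i\theta},w)\|_{L^\infty(\mathbb{T})}\ge c\,k_n^{c_5\epsilon}\quad\text{for all } n.$$ (2) If $T\ge 2$, then there is a weight $w$ with $1\le w\le T$ and a subsequence $\{k_n\}\subset\mathbb{N}$ such that $$\|\phi_{k_n}(e^{i\theta},w)\|_{L^\infty(\mathbb{T})}\ge c\,k_n^{1/2-c_6T^{-1/6}}\quad\text{for all } n.$$
   Context: A weight is a function $w\in L^1(-\pi,\pi)$ with $w\ge 0$ and $w\not\equiv 0$; the unit circle $\mathbb{T}$ is parametrized by $e^{i\theta}$, $\theta\in[-\pi,\pi)$. Bounds such as $1\le w\le T$ are understood for (almost) all $\theta\in[-\pi,\pi]$. For a weight $w$, $\{\phi_n(z,w)\}_{n\ge0}$ are the orthonormal polynomials: $\deg\phi_n=n$, the coefficient of $z^n$ in $\phi_n$ is positive, and $\int_{-\pi}^{\pi}\phi_n(e^{i\theta},w)\overline{\phi_m(e^{i\theta},w)}\,w(\theta)\,d\theta=\delta_{n,m}$. A subsequence $\{k_n\}\subset\mathbb{N}$ is a strictly increasing sequence of natural numbers. "Absolute constant" means independent of all parameters ($n,\epsilon,T$). *)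

theory Defs
  imports
    "HOL-Analysis.Analysis"
    "HOL-Probability.Essential_Supremum"
    "HOL-Computational_Algebra.Polynomial"
begin

text \<open>The unit circle is parametrized by \<open>cis \<theta> = exp (\<i> \<theta>)\<close> with
  \<open>\<theta>\<close> in the interval below, carrying the unnormalized Lebesgue measure \<open>d\<theta>\<close>.\<close>

abbreviation circle_measure :: "real measure" where
  "circle_measure \<equiv> lebesgue_on {-pi..pi}"

definition weight :: "(real \<Rightarrow> real) \<Rightarrow> bool" where
  "weight w \<longleftrightarrow>
     integrable circle_measure w \<and>
     (AE \<theta> in circle_measure. 0 \<le> w \<theta>) \<and>
     \<not> (AE \<theta> in circle_measure. w \<theta> = 0)"

definition weighted_inner :: "(real \<Rightarrow> real) \<Rightarrow> complex poly \<Rightarrow> complex poly \<Rightarrow> complex" where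
  "weighted_inner w p q =
     (LINT \<theta>|circle_measure. poly p (cis \<theta>) * cnj (poly q (cis \<theta>)) * complex_of_real (w \<theta>))"

definition orthonormal_polynomials :: "(real \<Rightarrow> real) \<Rightarrow> (nat \<Rightarrow> complex poly) \<Rightarrow> bool" where
  "orthonormal_polynomials w \<phi> \<longleftrightarrow>
     (\<forall>n. degree (\<phi> n) = n) \<and>
     (\<forall>n. coeff (\<phi> n) n \<in> \<real> \<and> 0 < Re (coeff (\<phi> n) n)) \<and>
     (\<forall>n m. weighted_inner w (\<phi> n) (\<phi> m) = (if n = m then 1 else 0))"

text \<open>\<open>esssup\<close> is \<open>\<infinity>\<close> on non-measurable functions; here it is only applied to
  polynomials, which are continuous on the circle.\<close>

definition Linf_norm_circle :: "(complex \<Rightarrow> complex) \<Rightarrow> ereal" where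
  "Linf_norm_circle f = esssup circle_measure (\<lambda>\<theta>. ereal (cmod (f (cis \<theta>))))"

text \<open>A weight has at most one system of orthonormal polynomials, so
  \<^const>\<open>orthonormal_polynomials\<close> determines \<open>\<phi>\<close> from \<open>w\<close>.\<close>

lemma integrable_weighted_inner:
  assumes "weight w"
  shows "integrable circle_measure
    (\<lambda>\<theta>. poly p (cis \<theta>) * cnj (poly q (cis \<theta>)) * complex_of_real (w \<theta>))"
proof -
  let ?f = "\<lambda>\<theta>. poly p (cis \<theta>) * cnj (poly q (cis \<theta>))"
  have c: "continuous_on {-pi..pi} ?f"
    by (intro continuous_intros)
  then have "bounded (?f ` {-pi..pi})"
    by (intro compact_imp_bounded compact_continuous_image) auto
  then obtain B where B: "\<And>\<theta>. \<theta> \<in> {-pi..pi} \<Longrightarrow> cmod (?f \<theta>) \<le> B"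
    unfolding bounded_iff by blast
  have w: "integrable circle_measure w" using assms by (simp add: weight_def)
  have m: "?f \<in> borel_measurable circle_measure"
    by (rule continuous_imp_measurable_on_sets_lebesgue[OF c]) auto
  show ?thesis
  proof (rule Bochner_Integration.integrable_bound[where f = "\<lambda>\<theta>. B * w \<theta>"])
    show "integrable circle_measure (\<lambda>\<theta>. B * w \<theta>)" using w by simp
    show "(\<lambda>\<theta>. ?f \<theta> * complex_of_real (w \<theta>)) \<in> borel_measurable circle_measure"
      using m borel_measurable_integrable[OF w] by measurable
    show "AE \<theta> in circle_measure. norm (?f \<theta> * complex_of_real (w \<theta>)) \<le> norm (B * w \<theta>)"
    proof (rule AE_I2)
      fix \<theta> assume "\<theta> \<in> space circle_measure"
      then have "cmod (?f \<theta>) \<le> \<bar>B\<bar>" using B[of \<theta>] by simp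
      then have "cmod (?f \<theta>) * \<bar>w \<theta>\<bar> \<le> \<bar>B\<bar> * \<bar>w \<theta>\<bar>"
        by (intro mult_right_mono) auto
      then show "norm (?f \<theta> * complex_of_real (w \<theta>)) \<le> norm (B * w \<theta>)"
        by (simp add: norm_mult abs_mult)
    qed
  qed
qed

lemma weighted_inner_diff_left:
  assumes "weight w"
  shows "weighted_inner w (p - q) r = weighted_inner w p r - weighted_inner w q r"
  unfolding weighted_inner_def
  by (subst Bochner_Integration.integral_diff[symmetric])
     (simp_all add: integrable_weighted_inner[OF assms] left_diff_distrib)

lemma weighted_inner_smult_left:
  "weighted_inner w (smult a p) r = a * weighted_inner w p r"
  unfolding weighted_inner_def by (simp add: mult.assoc)

lemma weighted_inner_cnj: "weighted_inner w q p = cnj (weighted_inner w p q)"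
  unfolding weighted_inner_def
  by (subst Bochner_Integration.integral_cnj[symmetric]) (simp add: mult.commute)

lemma degree_diff_smult_less:
  fixes p q :: "complex poly"
  assumes "degree p \<le> n" "degree q = n" "coeff q n \<noteq> 0"
    and r: "r = p - smult (coeff p n / coeff q n) q"
  shows "r = 0 \<or> degree r < n"
proof -
  have "degree r \<le> n"
    using assms by (auto intro!: degree_diff_le intro: order_trans[OF degree_smult_le])
  moreover have "coeff r n = 0" using assms by simp
  ultimately show ?thesis
    by (metis leading_coeff_0_iff le_neq_implies_less)
qed

lemma orthogonal_to_lower_degree:
  assumes w: "weight w" and \<phi>: "orthonormal_polynomials w \<phi>"
    and orth: "\<And>k. k < n \<Longrightarrow> weighted_inner w (\<phi> k) s = 0"
    and "p = 0 \<or> degree p < n"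
  shows "weighted_inner w p s = 0"
  using assms(4)
proof (induction "degree p" arbitrary: p rule: less_induct)
  case less
  show ?case
  proof (cases "p = 0")
    case True
    then show ?thesis by (simp add: weighted_inner_def)
  next
    case False
    let ?d = "degree p"
    define a where "a = coeff p ?d / coeff (\<phi> ?d) ?d"
    define r where "r = p - smult a (\<phi> ?d)"
    have "0 < Re (coeff (\<phi> ?d) ?d)" "degree (\<phi> ?d) = ?d"
      using \<phi> unfolding orthonormal_polynomials_def by blast+
    then have lc: "coeff (\<phi> ?d) ?d \<noteq> 0" "degree (\<phi> ?d) = ?d"
      by auto
    have d: "?d < n" using less.prems False by simp
    have "r = 0 \<or> degree r < ?d"
      using lc by (intro degree_diff_smult_less) (auto simp: r_def a_def)
    then have "weighted_inner w r s = 0"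
      using less.hyps[of r] d by (auto simp: weighted_inner_def)
    moreover have "weighted_inner w (smult a (\<phi> ?d)) s = 0"
      using orth[OF d] by (simp add: weighted_inner_smult_left)
    ultimately show ?thesis
      using weighted_inner_diff_left[OF w, of p "smult a (\<phi> ?d)" s] by (simp add: r_def)
  qed
qed

lemma orthonormal_polynomials_unique:
  assumes w: "weight w"
    and \<phi>: "orthonormal_polynomials w \<phi>" and \<psi>: "orthonormal_polynomials w \<psi>"
  shows "\<phi> = \<psi>"
proof
  fix n
  have ON\<phi>: "weighted_inner w (\<phi> i) (\<phi> j) = (if i = j then 1 else 0)"
    and ON\<psi>: "weighted_inner w (\<psi> i) (\<psi> j) = (if i = j then 1 else 0)" for i j
    using \<phi> \<psi> unfolding orthonormal_polynomials_def by auto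
  have deg: "degree (\<phi> i) = i" "degree (\<psi> i) = i" for i
    using \<phi> \<psi> unfolding orthonormal_polynomials_def by auto
  have lc: "\<exists>x>0. coeff (\<phi> i) i = complex_of_real x" "\<exists>x>0. coeff (\<psi> i) i = complex_of_real x" for i
    using \<phi> \<psi> unfolding orthonormal_polynomials_def by (metis of_real_Re)+
  obtain x y where x: "x > 0" "coeff (\<phi> n) n = complex_of_real x"
    and y: "y > 0" "coeff (\<psi> n) n = complex_of_real y"
    using lc by blast
  define a where "a = complex_of_real (x / y)"
  define r where "r = \<phi> n - smult a (\<psi> n)"
  have r: "r = 0 \<or> degree r < n"
    using deg x y by (intro degree_diff_smult_less[of "\<phi> n" n "\<psi> n"]) (auto simp: r_def a_def)
  have r\<phi>: "weighted_inner w r (\<phi> n) = 0"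
    by (rule orthogonal_to_lower_degree[OF w \<phi> _ r]) (simp add: ON\<phi>)
  have r\<psi>: "weighted_inner w r (\<psi> n) = 0"
    by (rule orthogonal_to_lower_degree[OF w \<psi> _ r]) (simp add: ON\<psi>)
  have 1: "weighted_inner w (\<phi> n) (\<psi> n) = a"
    using r\<psi> by (simp add: r_def weighted_inner_diff_left[OF w] weighted_inner_smult_left ON\<psi>)
  have "1 = a * weighted_inner w (\<psi> n) (\<phi> n)"
    using r\<phi> by (simp add: r_def weighted_inner_diff_left[OF w] weighted_inner_smult_left ON\<phi>)
  also have "\<dots> = complex_of_real ((x / y)\<^sup>2)"
    by (subst weighted_inner_cnj) (simp add: 1 a_def power2_eq_square)
  finally have "complex_of_real ((x / y)\<^sup>2) = 1" by (rule sym)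
  then have "(x / y)\<^sup>2 = 1" by (simp only: of_real_eq_1_iff)
  moreover have "0 < x / y" using x y by simp
  ultimately have "x / y = 1" by (auto simp only: power2_eq_1_iff)
  then have a: "a = 1" by (simp only: a_def of_real_1)
  have orth: "weighted_inner w r (\<phi> k) = 0" if "k < n" for k
  proof -
    have "weighted_inner w (\<phi> k) (\<psi> n) = 0"
      by (rule orthogonal_to_lower_degree[OF w \<psi>, of n]) (use that deg in \<open>auto simp: ON\<psi>\<close>)
    then have "weighted_inner w (\<psi> n) (\<phi> k) = 0"
      by (subst weighted_inner_cnj) simp
    then show ?thesis
      using that by (simp add: r_def weighted_inner_diff_left[OF w] weighted_inner_smult_left ON\<phi>)
  qed
  have "r = 0"
  proof (rule ccontr)
    assume nz: "r \<noteq> 0"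
    let ?d = "degree r"
    define b where "b = coeff r ?d / coeff (\<phi> ?d) ?d"
    define s where "s = r - smult b (\<phi> ?d)"
    have lc0: "coeff (\<phi> ?d) ?d \<noteq> 0" using lc(1)[of ?d] by auto
    then have "b \<noteq> 0" using nz by (simp add: b_def)
    have s: "s = 0 \<or> degree s < ?d"
      using deg lc0 by (intro degree_diff_smult_less) (auto simp: s_def b_def)
    have "weighted_inner w s (\<phi> ?d) = 0"
      by (rule orthogonal_to_lower_degree[OF w \<phi> _ s]) (simp add: ON\<phi>)
    moreover have "weighted_inner w r (\<phi> ?d) = 0"
      using orth r nz by blast
    ultimately have "b = 0"
      by (simp add: s_def weighted_inner_diff_left[OF w] weighted_inner_smult_left ON\<phi>)
    with \<open>b \<noteq> 0\<close> show False by simp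
  qed
  then show "\<phi> n = \<psi> n" by (simp add: r_def a)
qed

end

theory Submission
  imports Defs "HOL-Complex_Analysis.Conformal_Mappings" "HOL-Real_Asymp.Real_Asymp"
begin

text \<open>
  Let \<open>C\<close>, \<open>A\<close> be polynomials of degree less than \<open>n\<close> without zeros in the closed disc, with
  \<open>C(0) = A(0)\<close> and \<open>Re (C cnj A) > 0\<close> on the circle, and write \<open>p\<^sup>*(z) = z\<^sup>n cnj (p(z))\<close> there. Then
  \<open>(C - A + C\<^sup>* + A\<^sup>*) / 2\<close> is, up to a factor, the \<open>n\<close>-th orthogonal polynomial of the weight
  \<open>Re (C cnj A) / \<bar>E\<bar>\<^sup>2\<close> with \<open>E = C A - \<i> z\<^sup>n Im (C cnj A)\<close>. For \<open>C = Q F\<close>, \<open>A = Q / F\<close> and \<open>\<tau> = 2 arg F\<close>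
  the weight is \<open>\<bar>Q\<bar>\<^sup>-\<^sup>2\<close> times a factor between \<open>cos \<tau> / (1 + \<bar>sin \<tau>\<bar>)\<^sup>2\<close> and
  \<open>cos \<tau> / (1 - \<bar>sin \<tau>\<bar>)\<^sup>2\<close>, whatever the size of \<open>F\<close>, while the orthogonal polynomial at \<open>1\<close> is of
  the order of \<open>F(1)\<close>. Take \<open>F(z) \<approx> ((1 - \<rho>z) / (1 - rz))\<^sup>\<gamma>\<close> with \<open>r = 1 - 1/m\<close>,
  both \<open>F\<close> and \<open>1/F\<close> being replaced by the polynomials \<open>(1 \<plusminus> L/M)\<^sup>M\<close> for a truncated logarithm \<open>L\<close>; then \<open>\<bar>\<tau>\<bar> \<le> \<pi>\<gamma>\<close>, \<open>F(1) \<approx> m\<^sup>\<gamma>\<close> and \<open>n \<approx> m log\<^sup>2 m\<close>, and \<open>F \<approx> 1\<close> away from \<open>1\<close>.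

  Since every continuous positive weight is uniformly close to some \<open>\<bar>Q\<bar>\<^sup>-\<^sup>2\<close>, any continuous weight with
  values in \<open>(1, T)\<close> can be modified near \<open>1\<close> so as to produce this growth for one large \<open>n\<close>.
  Orthogonal polynomials of fixed degree depend continuously on the weight, so infinitely many
  such modifications, at smaller and smaller scales, converge to the required weight.
\<close>

subsection \<open>Orthogonal polynomials of bounded weights\<close>

lemma finite_circle_measure: "finite_measure circle_measure"
  using finite_measure_lebesgue_on[OF lmeasurable_cbox[of "-pi" pi]] by (simp add: cbox_interval)

lemma measure_circle_measure: "measure circle_measure (space circle_measure) = 2 * pi"
  by (simp add: measure_restrict_space)

lemma integral_circle_const: "(LINT \<theta>|circle_measure. (c::complex)) = 2 * pi * c"
  using measure_circle_measure by (simp add: scaleR_conv_of_real)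

lemma integrable_circle_bounded:
  fixes f :: "real \<Rightarrow> 'a::{banach,second_countable_topology}"
  assumes "f \<in> borel_measurable circle_measure" "\<And>\<theta>. \<theta> \<in> {-pi..pi} \<Longrightarrow> norm (f \<theta>) \<le> B"
  shows "integrable circle_measure f"
  by (rule finite_measure.integrable_const_bound[OF finite_circle_measure, of _ B])
     (use assms in auto)

lemma norm_integral_circle_le:
  fixes f :: "real \<Rightarrow> complex"
  assumes "integrable circle_measure f" "integrable circle_measure g"
    "\<And>\<theta>. \<theta> \<in> {-pi..pi} \<Longrightarrow> norm (f \<theta>) \<le> g \<theta>"
  shows "norm (LINT \<theta>|circle_measure. f \<theta>) \<le> (LINT \<theta>|circle_measure. g \<theta>)"
proof -
  have "norm (LINT \<theta>|circle_measure. f \<theta>) \<le> (LINT \<theta>|circle_measure. norm (f \<theta>))"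
    by (rule integral_norm_bound)
  also have "\<dots> \<le> (LINT \<theta>|circle_measure. g \<theta>)"
    using assms by (intro integral_mono) auto
  finally show ?thesis .
qed

text \<open>Cauchy's theorem for the closed disc: on the unit circle dz = \<i> z d\<theta>, so up to
  the factor -\<i> this is the contour integral of \<open>f\<close>.\<close>

lemma circle_mean_zero:
  assumes "continuous_on (cball 0 1) f" "f holomorphic_on ball 0 1"
  shows "(LINT \<theta>|circle_measure. cis \<theta> * f (cis \<theta>)) = 0"
proof -
  have "(f has_contour_integral 0) (part_circlepath 0 1 (-pi) pi)"
  proof (rule Cauchy_theorem_convex[where K = "{}"])
    show "f field_differentiable at x" if "x \<in> interior (cball 0 1) - {}" for x
      using that assms(2) by (auto simp: holomorphic_on_def at_within_open_NO_MATCH)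
    show "path_image (part_circlepath 0 1 (- pi) pi) \<subseteq> cball 0 (1::real)"
      using path_image_part_circlepath_subset'[of 1 0 "-pi" pi] by auto
  qed (use assms in \<open>auto simp: exp_eq_polar complex_eq_iff\<close>)
  then have "((\<lambda>t. f (cis t) * \<i> * cis t) has_integral 0) {-pi..pi}"
    by (subst (asm) has_contour_integral_part_circlepath_iff) auto
  then have "((\<lambda>t. (- \<i>) * (f (cis t) * \<i> * cis t)) has_integral (- \<i>) * 0) {-pi..pi}"
    by (rule has_integral_mult_right)
  then have "integral {-pi..pi} (\<lambda>t. cis t * f (cis t)) = 0"
    by (simp add: integral_unique mult_ac)
  moreover have "continuous_on {-pi..pi} (\<lambda>t. cis t * f (cis t))"
    by (intro continuous_intros continuous_on_compose2[OF assms(1)]) auto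
  then have "integrable circle_measure (\<lambda>t. cis t * f (cis t))"
    by (rule continuous_imp_integrable_real)
  ultimately show ?thesis
    by (subst lebesgue_integral_eq_integral) auto
qed

text \<open>After cancelling z cnj(z) = 1 a positive power of z or its conjugate remains, and
  positive powers have mean zero by \<open>circle_mean_zero\<close>.\<close>

lemma integral_cis_power:
  "(LINT \<theta>|circle_measure. cis \<theta> ^ i * cnj (cis \<theta> ^ j)) = (if i = j then 2 * pi else 0)"
proof -
  have up: "(LINT \<theta>|circle_measure. cis \<theta> ^ Suc k) = 0" for k
    using circle_mean_zero[of "\<lambda>z. z ^ k", OF continuous_on_power[OF continuous_on_id] holomorphic_on_power[OF holomorphic_on_ident]]
    by simp
  have unit: "cis \<theta> * cnj (cis \<theta>) = 1" for \<theta>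
    by (simp flip: complex_norm_square)
  consider "i = j" | k where "i = j + Suc k" | k where "j = i + Suc k"
    by (metis add_Suc_right less_imp_Suc_add linorder_neqE_nat)
  then show ?thesis
  proof cases
    case 1
    then have "cis \<theta> ^ i * cnj (cis \<theta> ^ j) = 1" for \<theta>
      using unit[of \<theta>] by (simp flip: power_mult_distrib)
    then show ?thesis using 1 integral_circle_const[of 1] by simp
  next
    case (2 k)
    have "cis \<theta> ^ i * cnj (cis \<theta> ^ j) = cis \<theta> ^ Suc k * (cis \<theta> * cnj (cis \<theta>)) ^ j" for \<theta>
      by (simp only: 2 power_add power_mult_distrib complex_cnj_power mult_ac)
    then have "cis \<theta> ^ i * cnj (cis \<theta> ^ j) = cis \<theta> ^ Suc k" for \<theta>
      by (simp only: unit power_one mult_1_right)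
    then show ?thesis using up[of k] 2 by (simp only:) simp
  next
    case (3 k)
    have "cis \<theta> ^ i * cnj (cis \<theta> ^ j) = cnj (cis \<theta> ^ Suc k) * (cis \<theta> * cnj (cis \<theta>)) ^ i" for \<theta>
      by (simp only: 3 power_add power_mult_distrib complex_cnj_power complex_cnj_mult mult_ac)
    then have "cis \<theta> ^ i * cnj (cis \<theta> ^ j) = cnj (cis \<theta> ^ Suc k)" for \<theta>
      by (simp only: unit power_one mult_1_right)
    then have "(LINT \<theta>|circle_measure. cis \<theta> ^ i * cnj (cis \<theta> ^ j)) = (LINT \<theta>|circle_measure. cnj (cis \<theta> ^ Suc k))"
      by (simp only: )
    also have "\<dots> = 0"
      by (subst Bochner_Integration.integral_cnj) (simp only: up complex_cnj_zero)
    finally show ?thesis using 3 by simp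
  qed
qed

text \<open>The bounds hold at every point of the interval, not just almost everywhere, so that they
  can be used pointwise and pass to pointwise limits.\<close>

definition bounded_weight :: "real \<Rightarrow> (real \<Rightarrow> real) \<Rightarrow> bool" where
  "bounded_weight T w \<longleftrightarrow> w \<in> borel_measurable circle_measure \<and> (\<forall>\<theta>\<in>{-pi..pi}. 1 \<le> w \<theta> \<and> w \<theta> \<le> T)"

lemma bounded_weightD:
  assumes "bounded_weight T w" "\<theta> \<in> {-pi..pi}"
  shows "1 \<le> w \<theta>" "w \<theta> \<le> T" "0 \<le> w \<theta>" "w \<theta> \<noteq> 0" "\<bar>w \<theta>\<bar> \<le> T"
  using assms unfolding bounded_weight_def by (smt (verit, best))+

lemma bounded_weight_imp_weight:
  assumes "bounded_weight T w"
  shows "weight w"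
proof -
  have "integrable circle_measure w"
    using assms bounded_weightD[OF assms]
    by (intro integrable_circle_bounded[of _ T]) (simp_all add: bounded_weight_def)
  moreover have "AE \<theta> in circle_measure. 0 \<le> w \<theta>"
    using bounded_weightD[OF assms] by (intro AE_I2) simp
  moreover have "\<not> (AE \<theta> in circle_measure. w \<theta> = 0)"
  proof
    assume "AE \<theta> in circle_measure. w \<theta> = 0"
    moreover have "AE \<theta> in circle_measure. w \<theta> \<noteq> 0"
      using bounded_weightD[OF assms] by (intro AE_I2) simp
    ultimately have "AE \<theta> in circle_measure. False" by eventually_elim auto
    then have "emeasure circle_measure (space circle_measure) = 0"
      by (simp only: eventually_False ae_filter_eq_bot_iff)
    then have "measure circle_measure (space circle_measure) = 0"
      by (simp only: measure_def enn2real_0)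
    then show False by (simp only: measure_circle_measure) simp
  qed
  ultimately show ?thesis by (simp add: weight_def)
qed

text \<open>Because \<open>degree 0 = 0\<close>, the condition \<open>degree p < n\<close> alone
  would exclude the zero polynomial for \<open>n = 0\<close>. The disjunction is the form of "degree
  below n" used throughout.\<close>

lemma poly_eq_sum_lessThan:
  fixes p :: "'a::comm_semiring_1 poly"
  assumes "p = 0 \<or> degree p < n"
  shows "poly p z = (\<Sum>i<n. coeff p i * z ^ i)"
proof (cases "p = 0")
  case False
  then have "degree p < n" using assms by simp
  then show ?thesis
    unfolding poly_altdef
    by (intro sum.mono_neutral_left ballI) (auto simp: coeff_eq_0)
qed simp

lemma weighted_inner_diff_right:
  assumes "weight w"
  shows "weighted_inner w p (q - r) = weighted_inner w p q - weighted_inner w p r"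
  by (metis assms complex_cnj_diff weighted_inner_cnj weighted_inner_diff_left)

lemma weighted_inner_smult_right:
  "weighted_inner w p (smult a q) = cnj a * weighted_inner w p q"
  by (metis complex_cnj_mult weighted_inner_cnj weighted_inner_smult_left)

lemma weighted_inner_zero [simp]: "weighted_inner w 0 q = 0" "weighted_inner w p 0 = 0"
  by (simp_all add: weighted_inner_def)

lemma weighted_inner_sum_left:
  assumes "weight w"
  shows "weighted_inner w (\<Sum>i\<in>I. f i) q = (\<Sum>i\<in>I. weighted_inner w (f i) q)"
proof (induction I rule: infinite_finite_induct)
  case (insert x F)
  have "weighted_inner w (f x + sum f F) q = weighted_inner w (f x) q + weighted_inner w (sum f F) q"
    using weighted_inner_diff_left[OF assms, of "f x + sum f F" "f x" q] by (simp add: algebra_simps)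
  then show ?case using insert by simp
qed auto

lemma weighted_inner_self:
  "weighted_inner w p p = of_real (LINT \<theta>|circle_measure. (cmod (poly p (cis \<theta>)))\<^sup>2 * w \<theta>)"
  unfolding weighted_inner_def
  by (subst integral_complex_of_real[symmetric], intro Bochner_Integration.integral_cong)
     (simp_all only: complex_norm_square of_real_mult)

text \<open>Parseval's identity for polynomials on the circle.\<close>

lemma weighted_inner_one:
  assumes "p = 0 \<or> degree p < n"
  shows "weighted_inner (\<lambda>_. 1) p p = 2 * pi * (\<Sum>i<n. (cmod (coeff p i))\<^sup>2)"
proof -
  have int: "integrable circle_measure (\<lambda>\<theta>. cis \<theta> ^ i * cnj (cis \<theta> ^ j))" for i j
    by (intro continuous_imp_integrable_real continuous_intros)
  have "weighted_inner (\<lambda>_. 1) p p =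
    (LINT \<theta>|circle_measure. (\<Sum>i<n. \<Sum>j<n. coeff p i * cnj (coeff p j) * (cis \<theta> ^ i * cnj (cis \<theta> ^ j))))"
    unfolding weighted_inner_def
    by (intro Bochner_Integration.integral_cong)
       (simp_all add: poly_eq_sum_lessThan[OF assms] sum_product mult_ac)
  also have "\<dots> = (\<Sum>i<n. \<Sum>j<n. coeff p i * cnj (coeff p j) * (LINT \<theta>|circle_measure. cis \<theta> ^ i * cnj (cis \<theta> ^ j)))"
    using int by (simp add: Bochner_Integration.integral_sum del: complex_cnj_power)
  also have "\<dots> = (\<Sum>i<n. coeff p i * cnj (coeff p i) * (2 * pi))"
    by (simp add: integral_cis_power if_distrib[of complex_of_real] if_distrib[of "\<lambda>x. _ * x"] sum.delta
             cong: if_cong del: complex_cnj_power)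
  also have "\<dots> = 2 * pi * (\<Sum>i<n. (cmod (coeff p i))\<^sup>2)"
    by (simp only: complex_norm_square of_real_mult of_real_sum sum_distrib_left) (simp add: mult_ac)
  finally show ?thesis .
qed

text \<open>Since the weight is at least 1, its norm dominates the unweighted one, which Parseval
  expresses by coefficients. This coercivity yields definiteness and, later, stability.\<close>

lemma weighted_inner_self_ge:
  assumes "bounded_weight T w" "p = 0 \<or> degree p < n"
  shows "2 * pi * (\<Sum>i<n. (cmod (coeff p i))\<^sup>2) \<le> Re (weighted_inner w p p)"
proof -
  have one: "bounded_weight 1 (\<lambda>_. 1)" by (simp add: bounded_weight_def)
  have i: "integrable circle_measure (\<lambda>\<theta>. (cmod (poly p (cis \<theta>)))\<^sup>2 * v \<theta>)" if "bounded_weight S v" for v S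
  proof -
    have "integrable circle_measure (\<lambda>\<theta>. Re (poly p (cis \<theta>) * cnj (poly p (cis \<theta>)) * complex_of_real (v \<theta>)))"
      by (intro integrable_Re integrable_weighted_inner bounded_weight_imp_weight[OF that])
    then show ?thesis
      by (simp flip: complex_norm_square add: cmod_power2)
  qed
  have "of_real (LINT \<theta>|circle_measure. (cmod (poly p (cis \<theta>)))\<^sup>2 * 1) = complex_of_real (2 * pi * (\<Sum>i<n. (cmod (coeff p i))\<^sup>2))"
    using weighted_inner_one[OF assms(2)] weighted_inner_self[of "\<lambda>_. 1" p] by simp
  then have "2 * pi * (\<Sum>i<n. (cmod (coeff p i))\<^sup>2) = (LINT \<theta>|circle_measure. (cmod (poly p (cis \<theta>)))\<^sup>2 * 1)"
    by (simp only: of_real_eq_iff)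
  also have "\<dots> \<le> (LINT \<theta>|circle_measure. (cmod (poly p (cis \<theta>)))\<^sup>2 * w \<theta>)"
    using i[OF one] i[OF assms(1)] assms(1)
    by (intro integral_mono) (auto simp: bounded_weight_def mult_le_cancel_left1)
  also have "\<dots> = Re (weighted_inner w p p)" by (simp add: weighted_inner_self)
  finally show ?thesis .
qed

lemma weighted_inner_self_pos:
  assumes "bounded_weight T w" "p \<noteq> 0"
  shows "0 < Re (weighted_inner w p p)" "Im (weighted_inner w p p) = 0"
proof -
  have "0 < 2 * pi * (cmod (coeff p (degree p)))\<^sup>2" using assms(2) by simp
  also have "\<dots> \<le> 2 * pi * (\<Sum>i<Suc (degree p). (cmod (coeff p i))\<^sup>2)"
    by (intro mult_left_mono member_le_sum) auto
  also have "\<dots> \<le> Re (weighted_inner w p p)"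
    by (intro weighted_inner_self_ge[OF assms(1)]) simp
  finally show "0 < Re (weighted_inner w p p)" .
  show "Im (weighted_inner w p p) = 0" by (simp add: weighted_inner_self)
qed

section \<open>Monic orthogonal polynomials: uniqueness, existence and size of the norm\<close>

definition monic_op :: "(real \<Rightarrow> real) \<Rightarrow> nat \<Rightarrow> complex poly \<Rightarrow> bool" where
  "monic_op w n P \<longleftrightarrow> degree P = n \<and> coeff P n = 1 \<and>
     (\<forall>q. q = 0 \<or> degree q < n \<longrightarrow> weighted_inner w P q = 0)"

lemma weighted_inner_lower_degree:
  assumes "weight w" "\<And>j. j < n \<Longrightarrow> weighted_inner w P (monom 1 j) = 0" "q = 0 \<or> degree q < n"
  shows "weighted_inner w P q = 0"
proof -
  have "q = (\<Sum>i<n. smult (coeff q i) (monom 1 i))"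
    using assms(3) by (intro poly_eqI) (auto simp: coeff_sum coeff_eq_0 smult_monom)
  then have "weighted_inner w q P = (\<Sum>i<n. coeff q i * weighted_inner w (monom 1 i) P)"
    using weighted_inner_sum_left[OF assms(1), of "\<lambda>i. smult (coeff q i) (monom 1 i)" "{..<n}" P]
    by (simp add: weighted_inner_smult_left)
  also have "\<dots> = 0"
    using assms(2) by (intro sum.neutral) (metis complex_cnj_zero lessThan_iff mult_zero_right weighted_inner_cnj)
  finally show ?thesis by (metis complex_cnj_zero weighted_inner_cnj)
qed

text \<open>The difference has degree below n, so it is orthogonal to both polynomials and hence to
  itself.\<close>

lemma monic_op_unique:
  assumes "bounded_weight T w" "monic_op w n P" "monic_op w n Q"
  shows "P = Q"
proof (rule ccontr)
  assume "P \<noteq> Q"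
  have "degree (P - Q) \<le> n" "coeff (P - Q) n = 0"
    using assms by (auto simp: monic_op_def intro: degree_diff_le)
  with \<open>P \<noteq> Q\<close> have "degree (P - Q) < n"
    by (metis leading_coeff_0_iff le_neq_implies_less right_minus_eq)
  then have "weighted_inner w P (P - Q) = 0" "weighted_inner w Q (P - Q) = 0"
    using assms by (auto simp: monic_op_def)
  then have "weighted_inner w (P - Q) (P - Q) = 0"
    by (simp add: weighted_inner_diff_left bounded_weight_imp_weight[OF assms(1)])
  then show False
    using weighted_inner_self_pos(1)[OF assms(1), of "P - Q"] \<open>P \<noteq> Q\<close> by simp
qed

text \<open>Gram-Schmidt: the projection of z^n onto the monic orthogonal polynomials of lower
  degree is subtracted from z^n.\<close>

lemma monic_op_exists:
  assumes "bounded_weight T w"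
  shows "\<exists>P. monic_op w n P"
proof (induction n rule: less_induct)
  case (less n)
  note w = bounded_weight_imp_weight[OF assms]
  obtain \<Phi> where \<Phi>: "\<And>k. k < n \<Longrightarrow> monic_op w k (\<Phi> k)"
    using less.IH by metis
  have nz: "\<Phi> k \<noteq> 0" if "k < n" for k using \<Phi>[OF that] by (auto simp: monic_op_def)
  have orth: "weighted_inner w (\<Phi> i) (\<Phi> k) = 0" if "i < n" "k < n" "i \<noteq> k" for i k
  proof (cases "k < i")
    case True
    then show ?thesis using \<Phi>[of i] \<Phi>[of k] that by (auto simp: monic_op_def)
  next
    case False
    then have "weighted_inner w (\<Phi> k) (\<Phi> i) = 0" using \<Phi>[of i] \<Phi>[of k] that by (auto simp: monic_op_def)
    then show ?thesis by (metis complex_cnj_zero weighted_inner_cnj)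
  qed
  define c where "c k = weighted_inner w (monom 1 n) (\<Phi> k) / weighted_inner w (\<Phi> k) (\<Phi> k)" for k
  define S where "S = (\<Sum>k<n. smult (c k) (\<Phi> k))"
  define P where "P = monom 1 n - S"
  have cS: "coeff S i = 0" if "i \<ge> n" for i
    unfolding S_def using that \<Phi> by (auto simp: coeff_sum monic_op_def coeff_eq_0 intro!: sum.neutral)
  have cn: "coeff P n = 1" by (simp add: P_def cS)
  have dP: "degree P = n"
    using cn by (intro antisym degree_le le_degree) (auto simp: P_def cS)
  have PPhi: "weighted_inner w P (\<Phi> k) = 0" if "k < n" for k
  proof -
    have "weighted_inner w S (\<Phi> k) = (\<Sum>i<n. c i * weighted_inner w (\<Phi> i) (\<Phi> k))"
      by (simp add: S_def weighted_inner_sum_left[OF w] weighted_inner_smult_left)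
    also have "\<dots> = (\<Sum>i<n. if i = k then c k * weighted_inner w (\<Phi> k) (\<Phi> k) else 0)"
      using orth that by (intro sum.cong) auto
    also have "\<dots> = weighted_inner w (monom 1 n) (\<Phi> k)"
      using weighted_inner_self_pos(1)[OF assms nz[OF that]] that
      by (auto simp: c_def)
    finally show ?thesis by (simp add: P_def weighted_inner_diff_left[OF w])
  qed
  \<comment> \<open>Orthogonality to the \<open>\<Phi> k\<close> extends to all lower degrees:
    removing the leading term of \<open>q\<close> with the monic \<open>\<Phi> ?d\<close> leaves a
    polynomial of smaller degree.\<close>
  have "weighted_inner w P q = 0" if "q = 0 \<or> degree q < n" for q
    using that
  proof (induction "degree q" arbitrary: q rule: less_induct)
    case less
    show ?case
    proof (cases "q = 0")
      case False
      let ?d = "degree q"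
      have d: "?d < n" using less.prems False by simp
      define r where "r = q - smult (coeff q ?d) (\<Phi> ?d)"
      have "r = 0 \<or> degree r < ?d"
        using \<Phi>[OF d] by (intro degree_diff_smult_less[of q _ "\<Phi> ?d"]) (auto simp: r_def monic_op_def)
      then have "weighted_inner w P r = 0"
        using less.hyps[of r] d by (cases "r = 0") auto
      then show ?thesis
        using PPhi[OF d] by (simp add: r_def weighted_inner_diff_right[OF w] weighted_inner_smult_right)
    qed simp
  qed
  then show ?case using dP cn unfolding monic_op_def by blast
qed

text \<open>Extremal property: among monic polynomials of degree n the orthogonal one has least
  norm, and the competitor z^n has squared norm equal to the integral of \<open>w\<close>.\<close>

lemma monic_op_norm_le:
  assumes "bounded_weight T w" "monic_op w n P"
  shows "Re (weighted_inner w P P) \<le> 2 * pi * T"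
proof -
  note w = bounded_weight_imp_weight[OF assms(1)]
  define q where "q = monom 1 n - P"
  have "q = 0 \<or> degree q < n"
    using assms(2) unfolding q_def
    by (intro degree_diff_smult_less[of "monom 1 n" n P]) (auto simp: monic_op_def degree_monom_eq)
  then have "weighted_inner w P q = 0" using assms(2) by (auto simp: monic_op_def)
  moreover from this have "weighted_inner w q P = 0" by (metis complex_cnj_zero weighted_inner_cnj)
  moreover have "weighted_inner w (P - q) (P - q) = weighted_inner w (P - q) P - weighted_inner w (P - q) q"
    by (rule weighted_inner_diff_right[OF w])
  \<comment> \<open>Pythagoras for the orthogonal decomposition z^n = P + q.\<close>
  moreover have "weighted_inner w (monom 1 n) (monom 1 n) = weighted_inner w P P + weighted_inner w q q"
  proof -
    have "weighted_inner w (monom 1 n) P = weighted_inner w P P"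
      using weighted_inner_diff_left[OF w, of "monom 1 n" P P] \<open>weighted_inner w q P = 0\<close> by (simp add: q_def)
    moreover have "weighted_inner w (monom 1 n) q = weighted_inner w q q"
      using weighted_inner_diff_left[OF w, of "monom 1 n" P q] \<open>weighted_inner w P q = 0\<close> by (simp add: q_def)
    ultimately show ?thesis
      using weighted_inner_diff_right[OF w, of "monom 1 n" "monom 1 n" P] unfolding q_def
      by (simp add: algebra_simps)
  qed
  moreover have "Re (weighted_inner w q q) \<ge> 0"
    using weighted_inner_self_pos(1)[OF assms(1), of q] by (cases "q = 0") auto
  moreover have "Re (weighted_inner w (monom 1 n) (monom 1 n)) \<le> 2 * pi * T"
  proof -
    have "Re (weighted_inner w (monom 1 n) (monom 1 n)) = (LINT \<theta>|circle_measure. w \<theta>)"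
      by (simp add: weighted_inner_self poly_monom norm_power)
    also have "\<dots> \<le> (LINT \<theta>|circle_measure. T)"
      using w assms(1) by (intro integral_mono) (auto simp: weight_def bounded_weight_def)
    also have "\<dots> = 2 * pi * T" using measure_circle_measure by simp
    finally show ?thesis .
  qed
  ultimately show ?thesis by simp
qed

text \<open>The orthonormal polynomials are the monic ones divided by their norms. The norm is at
  most sqrt(2 pi T), so lower bounds for monic polynomials transfer with this fixed loss.\<close>

lemma orthonormal_polynomials_exist:
  assumes "bounded_weight T w"
  shows "\<exists>\<phi>. orthonormal_polynomials w \<phi> \<and>
    (\<forall>n P. monic_op w n P \<longrightarrow> (\<forall>z. cmod (poly P z) \<le> sqrt (2 * pi * T) * cmod (poly (\<phi> n) z)))"
proof -
  note w = bounded_weight_imp_weight[OF assms]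
  obtain \<Phi> where \<Phi>: "\<And>n. monic_op w n (\<Phi> n)" using monic_op_exists[OF assms] by metis
  have nz: "\<Phi> k \<noteq> 0" for k using \<Phi>[of k] by (auto simp: monic_op_def)
  define N where "N n = Re (weighted_inner w (\<Phi> n) (\<Phi> n))" for n
  have N: "0 < N n" "weighted_inner w (\<Phi> n) (\<Phi> n) = of_real (N n)" for n
    using weighted_inner_self_pos[OF assms nz[of n]] by (auto simp: N_def complex_eq_iff)
  define \<phi> where "\<phi> n = smult (of_real (1 / sqrt (N n))) (\<Phi> n)" for n
  have orth: "weighted_inner w (\<Phi> i) (\<Phi> k) = 0" if "i \<noteq> k" for i k
    using \<Phi>[of i] \<Phi>[of k] that
    by (metis complex_cnj_zero linorder_neqE_nat monic_op_def weighted_inner_cnj)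
  have "orthonormal_polynomials w \<phi>"
    unfolding orthonormal_polynomials_def
  proof (intro conjI allI)
    fix n m
    show "degree (\<phi> n) = n" "coeff (\<phi> n) n \<in> \<real>" "0 < Re (coeff (\<phi> n) n)"
      using \<Phi>[of n] N(1)[of n] by (auto simp: \<phi>_def monic_op_def)
    have "sqrt (N n) * sqrt (N n) = N n" using N(1)[of n] by simp
    then have "complex_of_real (sqrt (N n)) * complex_of_real (sqrt (N n)) = N n"
      by (metis of_real_mult)
    then show "weighted_inner w (\<phi> n) (\<phi> m) = (if n = m then 1 else 0)"
      using orth[of n m] N[of n]
      by (auto simp: \<phi>_def weighted_inner_smult_left weighted_inner_smult_right)
  qed
  moreover have "cmod (poly P z) \<le> sqrt (2 * pi * T) * cmod (poly (\<phi> n) z)" if "monic_op w n P" for n P z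
  proof -
    have P: "P = \<Phi> n" by (rule monic_op_unique[OF assms that \<Phi>])
    have "N n \<le> 2 * pi * T" using monic_op_norm_le[OF assms \<Phi>] by (simp add: N_def)
    then have "sqrt (N n) \<le> sqrt (2 * pi * T)" by simp
    then have "sqrt (N n) * cmod (poly (\<phi> n) z) \<le> sqrt (2 * pi * T) * cmod (poly (\<phi> n) z)"
      by (intro mult_right_mono) auto
    moreover have "sqrt (N n) * cmod (poly (\<phi> n) z) = cmod (poly P z)"
      using N(1)[of n] by (simp add: \<phi>_def P norm_mult norm_divide)
    ultimately show ?thesis by simp
  qed
  ultimately show ?thesis by blast
qed

section \<open>Stability of orthogonal polynomials under perturbation of the weight\<close>

lemma sin_ge_linear:
  assumes "0 \<le> x" "x \<le> pi / 2"
  shows "2 * x / pi \<le> sin x"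
proof -
  \<comment> \<open>Jordan's inequality: sine is concave here and lies above the chord from 0 to
    pi/2.\<close>
  have "convex_on {0..pi/2} (\<lambda>x. - sin x)"
  proof (rule f''_ge0_imp_convex)
    show "((\<lambda>x. - sin x) has_real_derivative - cos x) (at x)" for x
      by (auto intro!: derivative_eq_intros)
    show "((\<lambda>x. - cos x) has_real_derivative sin x) (at x)" for x
      by (auto intro!: derivative_eq_intros)
  qed (auto intro!: sin_ge_zero)
  from convex_onD[OF this, of "2 * x / pi" 0 "pi / 2"] show ?thesis
    using assms by (simp add: field_simps)
qed

text \<open>The chord has length 2 sin(\<bar>\<theta>\<bar>/2), to which Jordan's inequality
  applies. This turns distance from 1 on the circle into distance of the angle from 0.\<close>

lemma cis_minus_one_ge:
  assumes "\<theta> \<in> {-pi..pi}"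
  shows "2 * \<bar>\<theta>\<bar> / pi \<le> cmod (cis \<theta> - 1)"
proof -
  have "(cmod (cis \<theta> - 1))\<^sup>2 = (cos \<theta> - 1)\<^sup>2 + (sin \<theta>)\<^sup>2"
    by (simp add: cmod_power2)
  also have "\<dots> = 2 - 2 * cos (2 * (\<bar>\<theta>\<bar> / 2))"
    using sin_cos_squared_add[of \<theta>] by (simp add: power2_eq_square algebra_simps)
  also have "\<dots> = (2 * sin (\<bar>\<theta>\<bar> / 2))\<^sup>2"
    by (subst cos_double_sin) (simp add: power2_eq_square)
  finally have "(cmod (cis \<theta> - 1))\<^sup>2 = (2 * sin (\<bar>\<theta>\<bar> / 2))\<^sup>2" .
  moreover have s: "2 * (\<bar>\<theta>\<bar> / 2) / pi \<le> sin (\<bar>\<theta>\<bar> / 2)"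
    by (rule sin_ge_linear) (use assms in auto)
  then have "0 \<le> 2 * sin (\<bar>\<theta>\<bar> / 2)"
    by (smt (verit) assms divide_nonneg_pos pi_gt_zero abs_ge_zero)
  ultimately have "cmod (cis \<theta> - 1) = 2 * sin (\<bar>\<theta>\<bar> / 2)"
    using power2_eq_imp_eq norm_ge_zero by blast
  with s show ?thesis by simp
qed

lemma integrable_bounded_weight_diff:
  assumes "bounded_weight T w" "bounded_weight T w'"
  shows "integrable circle_measure (\<lambda>\<theta>. \<bar>w' \<theta> - w \<theta>\<bar>)"
  using assms[THEN bounded_weight_imp_weight] by (simp add: weight_def)

text \<open>The difference q = P' - P has degree below n, so it is orthogonal to P' under w' and to
  P under w. Hence the squared w'-norm of q equals the integral of P cnj(q) (w - w'), which is
  linear in q, while coercivity bounds it below quadratically.\<close>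

lemma monic_op_diff_le:
  assumes w: "bounded_weight T w" and w': "bounded_weight T w'"
    and P: "monic_op w n P" and P': "monic_op w' n P'"
    and S: "\<And>\<theta>. \<theta> \<in> {-pi..pi} \<Longrightarrow> cmod (poly P (cis \<theta>)) \<le> S" and z: "cmod z \<le> 1"
  shows "cmod (poly P' z - poly P z) \<le> (real n)\<^sup>2 * S * (LINT \<theta>|circle_measure. \<bar>w' \<theta> - w \<theta>\<bar>)"
proof -
  define D where "D = (LINT \<theta>|circle_measure. \<bar>w' \<theta> - w \<theta>\<bar>)"
  define q where "q = P' - P"
  have q: "q = 0 \<or> degree q < n"
    using P P' unfolding q_def
    by (intro degree_diff_smult_less[of P' n P]) (auto simp: monic_op_def)
  \<comment> \<open>Up to the factor 2 pi, \<open>X\<close> is the unweighted squared norm of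
    \<open>q\<close>; each coefficient is at most sqrt X, so \<bar>q\<bar> is at most n sqrt X on
    the disc.\<close>
  define X where "X = (\<Sum>i<n. (cmod (coeff q i))\<^sup>2)"
  have X0: "0 \<le> X" by (simp add: X_def sum_nonneg)
  have S0: "0 \<le> S" using S[of 0] norm_ge_zero[of "poly P (cis 0)"] by (simp del: norm_ge_zero)
  have D0: "0 \<le> D" unfolding D_def by (rule Bochner_Integration.integral_nonneg) simp
  have coeff_le: "cmod (coeff q i) \<le> sqrt X" if "i < n" for i
    unfolding X_def using that by (intro real_le_rsqrt member_le_sum) auto
  have q_le: "cmod (poly q v) \<le> n * sqrt X" if "cmod v \<le> 1" for v
  proof -
    have "cmod (poly q v) \<le> (\<Sum>i<n. cmod (coeff q i * v ^ i))"
      unfolding poly_eq_sum_lessThan[OF q] by (rule norm_sum)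
    also have "\<dots> \<le> (\<Sum>i<n. sqrt X * 1)"
      using coeff_le that unfolding norm_mult norm_power
      by (intro sum_mono mult_mono power_le_one) (auto simp: X0)
    finally show ?thesis by simp
  qed
  note i = integrable_weighted_inner[OF bounded_weight_imp_weight[OF w], of P q]
    integrable_weighted_inner[OF bounded_weight_imp_weight[OF w'], of P q]
  have "weighted_inner w' P' q = 0" "weighted_inner w P q = 0"
    using P P' q by (auto simp: monic_op_def)
  then have "weighted_inner w' q q = weighted_inner w P q - weighted_inner w' P q"
    by (simp add: q_def weighted_inner_diff_left[OF bounded_weight_imp_weight[OF w']])
  also have "\<dots> = (LINT \<theta>|circle_measure. poly P (cis \<theta>) * cnj (poly q (cis \<theta>)) * of_real (w \<theta>) -
      poly P (cis \<theta>) * cnj (poly q (cis \<theta>)) * of_real (w' \<theta>))"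
    unfolding weighted_inner_def using i by (rule Bochner_Integration.integral_diff[symmetric])
  finally have "cmod (weighted_inner w' q q) \<le> (LINT \<theta>|circle_measure. S * (n * sqrt X) * \<bar>w' \<theta> - w \<theta>\<bar>)"
  proof (elim ssubst, intro norm_integral_circle_le)
    fix \<theta> assume \<theta>: "\<theta> \<in> {-pi..pi}"
    have "cmod (poly P (cis \<theta>) * cnj (poly q (cis \<theta>)) * of_real (w \<theta>) - poly P (cis \<theta>) * cnj (poly q (cis \<theta>)) * of_real (w' \<theta>))
      = cmod (poly P (cis \<theta>) * cnj (poly q (cis \<theta>)) * of_real (w \<theta> - w' \<theta>))"
      by (simp add: algebra_simps)
    also have "\<dots> = cmod (poly P (cis \<theta>)) * cmod (poly q (cis \<theta>)) * \<bar>w' \<theta> - w \<theta>\<bar>"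
      unfolding norm_mult norm_of_real by (simp add: abs_minus_commute)
    also have "\<dots> \<le> S * (n * sqrt X) * \<bar>w' \<theta> - w \<theta>\<bar>"
      using S[OF \<theta>] q_le[of "cis \<theta>"] S0 by (intro mult_right_mono mult_mono) auto
    finally show "cmod (poly P (cis \<theta>) * cnj (poly q (cis \<theta>)) * of_real (w \<theta>) - poly P (cis \<theta>) * cnj (poly q (cis \<theta>)) * of_real (w' \<theta>)) \<le> S * (n * sqrt X) * \<bar>w' \<theta> - w \<theta>\<bar>" .
  qed (use i integrable_bounded_weight_diff[OF w w'] in auto)
  also have "\<dots> = S * (n * sqrt X) * D"
    by (simp add: D_def)
  finally have "Re (weighted_inner w' q q) \<le> S * (n * sqrt X) * D"
    using complex_Re_le_cmod order_trans by blast
  then have "2 * pi * X \<le> S * (n * sqrt X) * D"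
    using weighted_inner_self_ge[OF w' q] unfolding X_def by linarith
  moreover have "X \<le> 2 * pi * X" using X0 pi_gt3 by (intro mult_le_cancel_right1[THEN iffD2]) auto
  ultimately have "sqrt X * sqrt X \<le> (S * n * D) * sqrt X" using X0 by (simp add: mult_ac)
  then have "sqrt X \<le> S * n * D"
  proof (cases "X = 0")
    case True
    then show ?thesis using S0 D0 by simp
  next
    case False
    then have "0 < sqrt X" using X0 by simp
    with \<open>sqrt X * sqrt X \<le> (S * n * D) * sqrt X\<close> show ?thesis by (rule mult_right_le_imp_le)
  qed
  then have "n * sqrt X \<le> n * (S * n * D)" by (intro mult_left_mono) auto
  with q_le[OF z] show ?thesis
    by (simp add: q_def D_def power2_eq_square mult_ac)
qed

text \<open>For fixed degree only the L1 distance of the weights matters. A single \<sigma> controls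
  both the size of an arc around 1 where the new weight is arbitrary within its bounds and the
  deviation outside it.\<close>

lemma monic_op_stable:
  assumes w: "bounded_weight T w" and P: "monic_op w n P" and e: "0 < e"
  shows "\<exists>\<sigma>>0. \<forall>w' P'. bounded_weight T w' \<longrightarrow> monic_op w' n P' \<longrightarrow>
     (\<forall>\<theta>\<in>{-pi..pi}. \<sigma> \<le> cmod (cis \<theta> - 1) \<longrightarrow> \<bar>w' \<theta> - w \<theta>\<bar> \<le> 2 * \<sigma>) \<longrightarrow>
     cmod (poly P' 1 - poly P 1) \<le> e"
proof -
  have "compact ((\<lambda>\<theta>. poly P (cis \<theta>)) ` {-pi..pi})"
    by (intro compact_continuous_image continuous_intros) auto
  then obtain S where S: "\<And>\<theta>. \<theta> \<in> {-pi..pi} \<Longrightarrow> cmod (poly P (cis \<theta>)) \<le> S"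
    by (meson bounded_iff compact_imp_bounded imageI)
  have S0: "0 \<le> S" using S[of 0] norm_ge_zero[of "poly P (cis 0)"] by (simp del: norm_ge_zero)
  have T: "1 \<le> T" using bounded_weightD(1,2)[OF w, of 0] by simp
  \<comment> \<open>The term 4 T comes from an interval of length 4 \<sigma> on which the weights
    differ by at most T, and 4 pi from a deviation 2 \<sigma> over length 2 pi. The final 1 keeps
    \<open>K\<close> positive.\<close>
  define K where "K = (real n)\<^sup>2 * S * (4 * T + 4 * pi) + 1"
  have K0: "0 \<le> (real n)\<^sup>2 * S * (4 * T + 4 * pi)"
    using S0 T by (intro mult_nonneg_nonneg) auto
  then have K: "0 < K" by (simp add: K_def)
  show ?thesis
  proof (intro exI[of _ "e / K"] conjI allI impI)
    fix w' P'
    assume w': "bounded_weight T w'" and P': "monic_op w' n P'"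
      and close: "\<forall>\<theta>\<in>{-pi..pi}. e / K \<le> cmod (cis \<theta> - 1) \<longrightarrow> \<bar>w' \<theta> - w \<theta>\<bar> \<le> 2 * (e / K)"
    define \<sigma> where "\<sigma> = e / K"
    have \<sigma>: "0 < \<sigma>" using K e by (simp add: \<sigma>_def)
    have "indicat_real {-2*\<sigma>..2*\<sigma>} \<in> borel_measurable circle_measure"
      by (intro measurable_restrict_space1 borel_measurable_indicator) simp
    then have ind: "integrable circle_measure (indicat_real {-2*\<sigma>..2*\<sigma>})"
      by (rule integrable_circle_bounded[of _ 1]) (simp add: indicator_def)
    have "(LINT \<theta>|circle_measure. \<bar>w' \<theta> - w \<theta>\<bar>) \<le>
        (LINT \<theta>|circle_measure. T * indicator {-2*\<sigma>..2*\<sigma>} \<theta> + 2 * \<sigma>)"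
    proof (rule integral_mono)
      show "integrable circle_measure (\<lambda>\<theta>. T * indicator {-2*\<sigma>..2*\<sigma>} \<theta> + 2 * \<sigma>)"
        using ind by simp
      fix \<theta> assume "\<theta> \<in> space circle_measure"
      then have \<theta>: "\<theta> \<in> {-pi..pi}" by simp
      show "\<bar>w' \<theta> - w \<theta>\<bar> \<le> T * indicator {-2*\<sigma>..2*\<sigma>} \<theta> + 2 * \<sigma>"
      proof (cases "\<sigma> \<le> cmod (cis \<theta> - 1)")
        case True
        then show ?thesis using close \<theta> T by (auto simp: \<sigma>_def indicator_def intro: add_increasing)
      next
        case False
        then have "2 * \<bar>\<theta>\<bar> / pi < \<sigma>" using cis_minus_one_ge[OF \<theta>] by linarith
        then have "2 * \<bar>\<theta>\<bar> < \<sigma> * pi" by (simp add: field_simps)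
        also have "\<sigma> * pi \<le> \<sigma> * 4" using \<sigma> pi_less_4 by (intro mult_left_mono) auto
        finally have "\<theta> \<in> {-2*\<sigma>..2*\<sigma>}" by auto
        then show ?thesis using bounded_weightD(1,2)[OF w \<theta>] bounded_weightD(1,2)[OF w' \<theta>] \<sigma> by simp
      qed
    qed (rule integrable_bounded_weight_diff[OF w w'])
    also have "\<dots> = T * measure circle_measure ({-2*\<sigma>..2*\<sigma>} \<inter> {-pi..pi}) + 2 * \<sigma> * (2 * pi)"
      using ind measure_circle_measure by simp
    also have "\<dots> \<le> T * (4 * \<sigma>) + 2 * \<sigma> * (2 * pi)"
    proof -
      have "measure circle_measure ({-2*\<sigma>..2*\<sigma>} \<inter> {-pi..pi}) = measure lebesgue ({-2*\<sigma>..2*\<sigma>} \<inter> {-pi..pi})"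
        by (rule measure_restrict_space) auto
      also have "\<dots> \<le> measure lebesgue {-2*\<sigma>..2*\<sigma>}"
        by (intro measure_mono_fmeasurable) auto
      also have "\<dots> = 4 * \<sigma>" using \<sigma> by simp
      finally show ?thesis using T by (simp add: mult_left_mono)
    qed
    also have "\<dots> = (4 * T + 4 * pi) * \<sigma>" by (simp add: algebra_simps)
    finally have "(LINT \<theta>|circle_measure. \<bar>w' \<theta> - w \<theta>\<bar>) \<le> (4 * T + 4 * pi) * \<sigma>" .
    then have "(real n)\<^sup>2 * S * (LINT \<theta>|circle_measure. \<bar>w' \<theta> - w \<theta>\<bar>) \<le> (real n)\<^sup>2 * S * ((4 * T + 4 * pi) * \<sigma>)"
      using S0 by (intro mult_left_mono) auto
    also have "\<dots> \<le> K * \<sigma>" using \<sigma> by (simp add: K_def algebra_simps)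
    also have "\<dots> = e" using K by (simp add: \<sigma>_def)
    finally show "cmod (poly P' 1 - poly P 1) \<le> e"
      using monic_op_diff_le[OF w w' P P' S, of 1] by simp
  qed (use K e in simp)
qed

subsection \<open>Weights with a prescribed orthogonal polynomial\<close>

text \<open>The reversed polynomial p* of the theory of orthogonal polynomials on the circle. The
  order n is a separate parameter because it is applied to polynomials of degree less than
  n.\<close>

definition rev_poly :: "nat \<Rightarrow> complex poly \<Rightarrow> complex poly" where
  "rev_poly n p = (\<Sum>i\<le>n. monom (cnj (coeff p (n - i))) i)"

lemma coeff_rev_poly: "coeff (rev_poly n p) k = (if k \<le> n then cnj (coeff p (n - k)) else 0)"
  by (simp add: rev_poly_def coeff_sum)

lemma poly_rev_poly:
  assumes "cmod z = 1" "degree p \<le> n"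
  shows "poly (rev_poly n p) z = z ^ n * cnj (poly p z)"
proof -
  have z: "z ^ n * cnj (z ^ i) = z ^ (n - i)" if "i \<le> n" for i
  proof -
    have "z ^ n * cnj (z ^ i) = z ^ (n - i) * (z * cnj z) ^ i"
      using that by (simp add: power_mult_distrib flip: power_add mult.assoc)
    then show ?thesis using assms(1) by (simp flip: complex_norm_square)
  qed
  have "poly p z = (\<Sum>i\<le>n. coeff p i * z ^ i)"
    using poly_eq_sum_lessThan[of p "Suc n" z] assms(2) by (simp add: lessThan_Suc_atMost)
  then have "z ^ n * cnj (poly p z) = (\<Sum>i\<le>n. cnj (coeff p i) * (z ^ n * cnj (z ^ i)))"
    by (simp add: sum_distrib_left mult_ac)
  also have "\<dots> = (\<Sum>i\<le>n. cnj (coeff p i) * z ^ (n - i))"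
    by (intro sum.cong refl) (simp only: z atMost_iff)
  also have "\<dots> = (\<Sum>i\<le>n. cnj (coeff p (n - i)) * z ^ i)"
    by (rule sum.reindex_bij_witness[of _ "\<lambda>i. n - i" "\<lambda>i. n - i"]) auto
  also have "\<dots> = poly (rev_poly n p) z"
    by (simp add: rev_poly_def poly_sum poly_monom)
  finally show ?thesis ..
qed

text \<open>The strict degree bounds make the leading coefficient of \<open>opoly\<close> equal to
  cnj(C(0)); \<open>coeff0\<close> makes C - A vanish at 0; \<open>nz\<close> and
  \<open>Re_pos\<close> keep \<open>E\<close> free of zeros and the weight positive.\<close>

locale op_block =
  fixes C A :: "complex poly" and n :: nat
  assumes deg: "degree C < n" "degree A < n"
    and coeff0: "coeff C 0 = coeff A 0"
    and nz: "\<And>z. cmod z \<le> 1 \<Longrightarrow> poly C z \<noteq> 0" "\<And>z. cmod z \<le> 1 \<Longrightarrow> poly A z \<noteq> 0"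
    and Re_pos: "\<And>z. cmod z = 1 \<Longrightarrow> 0 < Re (poly C z * cnj (poly A z))"
begin

text \<open>Written with reversed polynomials, the denominator is a polynomial and so is analytic in
  the disc, although its boundary values involve an imaginary part.\<close>

definition E :: "complex poly" where
  "E = C * A - smult (1/2) (C * rev_poly n A - rev_poly n C * A)"

definition opoly :: "complex poly" where
  "opoly = smult (1/2) (C - A + rev_poly n C + rev_poly n A)"

definition wt :: "complex \<Rightarrow> real" where
  "wt z = Re (poly C z * cnj (poly A z)) / (cmod (poly E z))\<^sup>2"

lemma rev_eq:
  assumes "cmod z = 1"
  shows "poly (rev_poly n C) z = z ^ n * cnj (poly C z)" "poly (rev_poly n A) z = z ^ n * cnj (poly A z)"
  using assms deg by (auto intro!: poly_rev_poly)

lemma E_circle: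
  assumes "cmod z = 1"
  shows "poly E z = poly C z * poly A z - \<i> * z ^ n * Im (poly C z * cnj (poly A z))"
proof -
  define u where "u = poly C z * cnj (poly A z)"
  have "\<i> * complex_of_real (Im u) = (u - cnj u) / 2"
    by (simp add: complex_eq_iff)
  moreover have "cnj u = cnj (poly C z) * poly A z" by (simp add: u_def)
  ultimately have "\<i> * complex_of_real (Im u) = (u - cnj (poly C z) * poly A z) / 2"
    by simp
  then have "\<i> * z ^ n * Im u = z ^ n * (u - cnj (poly C z) * poly A z) / 2"
    by (metis mult.assoc mult.left_commute times_divide_eq_right)
  moreover have "poly E z = poly C z * poly A z - z ^ n * (u - cnj (poly C z) * poly A z) / 2"
    unfolding E_def u_def by (simp add: rev_eq[OF assms] algebra_simps diff_divide_distrib)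
  ultimately show ?thesis unfolding u_def by (simp only:)
qed

text \<open>Write E = C A (1 - f) with f analytic. On the circle \<bar>f\<bar> = \<bar>Im u\<bar> /
  \<bar>u\<bar> for u = C cnj(A), which is less than 1 because Re u > 0; the maximum principle
  carries this into the disc.\<close>

lemma E_nonzero:
  assumes "cmod z \<le> 1"
  shows "poly E z \<noteq> 0"
proof -
  define f where "f z = (poly C z * poly (rev_poly n A) z - poly (rev_poly n C) z * poly A z) / (2 * (poly C z * poly A z))" for z
  have f_eq: "poly E z = poly C z * poly A z * (1 - f z)" if "cmod z \<le> 1" for z
    using nz that by (simp add: E_def f_def field_simps)
  have contf: "continuous_on (cball 0 1) f"
    unfolding f_def using nz by (intro continuous_intros) auto
  have holf: "f holomorphic_on ball 0 1"
    unfolding f_def using nz by (intro holomorphic_intros) auto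
  have "compact (sphere (0::complex) 1)" "sphere (0::complex) 1 \<noteq> {}" by auto
  moreover have "continuous_on (sphere 0 1) (\<lambda>z. cmod (f z))"
    using contf by (intro continuous_intros) (auto elim: continuous_on_subset)
  ultimately obtain x where x: "cmod x = 1" "\<And>y. cmod y = 1 \<Longrightarrow> cmod (f y) \<le> cmod (f x)"
    using continuous_attains_sup[of "sphere (0::complex) 1" "\<lambda>z. cmod (f z)"] by auto
  have fx: "cmod (f x) < 1"
  proof -
    let ?u = "poly C x * cnj (poly A x)"
    have "poly C x * poly A x * f x = \<i> * x ^ n * Im ?u"
      using f_eq[of x] E_circle[OF x(1)] x(1) by (simp add: algebra_simps)
    then have "cmod ?u * cmod (f x) = \<bar>Im ?u\<bar>"
      using x(1) by (metis (no_types) norm_mult norm_of_real norm_ii mult_1 norm_power power_one complex_mod_cnj)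
    moreover have "\<bar>Im ?u\<bar> < cmod ?u"
    proof -
      have "\<bar>Im ?u\<bar>\<^sup>2 < (cmod ?u)\<^sup>2"
        using Re_pos[OF x(1)] unfolding cmod_power2 by (simp del: times_complex.sel)
      then show ?thesis using power_less_imp_less_base norm_ge_zero by blast
    qed
    ultimately have "cmod ?u * cmod (f x) < cmod ?u * 1" by simp
    then show ?thesis by (rule mult_left_less_imp_less) simp
  qed
  have "cmod (f z) \<le> cmod (f x)"
    by (rule maximum_modulus_frontier[of f "cball 0 1"]) (use holf contf x(2) assms in auto)
  with fx have "f z \<noteq> 1" by auto
  then show ?thesis using f_eq[OF assms] nz[OF assms] by simp
qed

lemma continuous_wt: "continuous_on (sphere 0 1) wt"
  unfolding wt_def using E_nonzero by (intro continuous_intros) auto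

text \<open>The product splits into z^n times boundary values of an analytic function and the
  conjugate of an analytic function vanishing at 0. Against cnj(z^j) with j < n both parts have mean
  zero.\<close>

lemma opoly_wt:
  assumes "cmod z = 1"
  shows "poly opoly z * wt z = z ^ n * (poly (C + A) z / (2 * poly E z)) + cnj (poly (C - A) z / (2 * poly E z))"
proof -
  \<comment> \<open>Treating conjugates as independent letters reduces the claim to a polynomial
    identity modulo \<open>Z * Z' = 1\<close>.\<close>
  define c a c' a' Z Z' e e' where defs: "c = poly C z" "a = poly A z" "c' = cnj c" "a' = cnj a"
    "Z = z ^ n" "Z' = cnj Z" "e = poly E z" "e' = cnj e"
  have "Z * Z' = 1" using assms unfolding defs
    by (metis complex_norm_square norm_power of_real_1 power_one)
  have e: "e = c * a - (c * (Z * a') - Z * c' * a) / 2"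
    unfolding defs E_def by (simp add: rev_eq[OF assms])
  then have e': "e' = c' * a' - (c' * (Z' * a) - Z' * c * a') / 2"
    unfolding defs by simp
  have nz: "e \<noteq> 0" "e' \<noteq> 0" using E_nonzero[of z] assms by (auto simp: defs)
  have w: "complex_of_real (wt z) = ((c * a' + c' * a) / 2) / (e * e')"
  proof -
    define u where "u = c * a'"
    have "complex_of_real (Re u) = (u + cnj u) / 2" by (simp add: complex_eq_iff)
    also have "cnj u = c' * a" by (simp add: u_def defs)
    finally show ?thesis
      unfolding wt_def of_real_divide complex_norm_square u_def defs by (simp only: mult_ac)
  qed
  have p: "poly opoly z = (c - a + Z * c' + Z * a') / 2"
    by (simp add: opoly_def rev_eq[OF assms] defs)
  have "(c - a + Z * c' + Z * a') * (c * a' + c' * a) = 2 * (Z * (c + a) * e' + (c' - a') * e)"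
    unfolding e e' using \<open>Z * Z' = 1\<close> by (simp add: field_simps) algebra
  then have "(c - a + Z * c' + Z * a') / 2 * (((c * a' + c' * a) / 2) / (e * e')) =
    Z * ((c + a) / (2 * e)) + (c' - a') / (2 * e')"
    using nz by (simp add: field_simps)
  then show ?thesis unfolding p w by (simp add: defs)
qed

lemma opoly_orthogonal:
  assumes "j < n"
  shows "weighted_inner (\<lambda>\<theta>. wt (cis \<theta>)) opoly (monom 1 j) = 0"
proof -
  \<comment> \<open>The equality of the constant terms gives C - A = z D.\<close>
  obtain D where D: "C - A = pCons 0 D"
  proof (cases "C - A")
    case (pCons a q)
    then have "a = 0" using coeff0 by (metis coeff_diff coeff_pCons_0 right_minus_eq)
    then show ?thesis using pCons that by blast
  qed
  define F where "F z = z ^ (n - j - 1) * (poly (C + A) z / (2 * poly E z))" for z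
  define G where "G z = z ^ j * (poly D z / (2 * poly E z))" for z
  have cont: "continuous_on (cball 0 1) F" "continuous_on (cball 0 1) G"
    unfolding F_def G_def using E_nonzero by (auto intro!: continuous_intros)
  have hol: "F holomorphic_on ball 0 1" "G holomorphic_on ball 0 1"
    unfolding F_def G_def using E_nonzero by (auto intro!: holomorphic_intros)
  have pt: "poly opoly (cis \<theta>) * cnj (poly (monom 1 j) (cis \<theta>)) * of_real (wt (cis \<theta>)) =
    cis \<theta> * F (cis \<theta>) + cnj (cis \<theta> * G (cis \<theta>))" for \<theta>
  proof -
    define z where "z = cis \<theta>"
    have z: "cmod z = 1" "z * cnj z = 1" by (auto simp: z_def simp flip: complex_norm_square)
    have zj: "z ^ j * cnj z ^ j = 1" by (metis power_mult_distrib power_one z(2))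
    have zn: "z ^ n * cnj (z ^ j) = z * z ^ (n - j - 1)"
    proof -
      have "z ^ n = z * z ^ (n - j - 1) * z ^ j"
        using assms by (metis Suc_diff_Suc add.commute diff_Suc_eq_diff_pred le_add_diff_inverse2 less_imp_le_nat power_Suc power_add diff_Suc_1 diff_diff_left plus_1_eq_Suc)
      then show ?thesis using zj by (simp add: mult.assoc)
    qed
    have "poly (C - A) z = z * poly D z" by (simp only: D poly_pCons add_0)
    then have "poly opoly z * wt z * cnj (z ^ j) =
      (z ^ n * cnj (z ^ j)) * (poly (C + A) z / (2 * poly E z)) + cnj (z * z ^ j * (poly D z / (2 * poly E z)))"
      unfolding opoly_wt[OF z(1)] by (simp add: algebra_simps)
    then show ?thesis unfolding zn F_def G_def by (simp add: poly_monom z_def mult_ac)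
  qed
  have i: "integrable circle_measure (\<lambda>\<theta>. cis \<theta> * F (cis \<theta>))" "integrable circle_measure (\<lambda>\<theta>. cis \<theta> * G (cis \<theta>))"
    by (intro continuous_imp_integrable_real continuous_intros continuous_on_compose2[OF cont(1)] continuous_on_compose2[OF cont(2)]; auto)+
  show ?thesis
    unfolding weighted_inner_def pt
    using i circle_mean_zero[OF cont(1) hol(1)] circle_mean_zero[OF cont(2) hol(2)]
    by (subst Bochner_Integration.integral_add)
       (simp_all add: Bochner_Integration.integral_cnj del: complex_cnj_mult)
qed

lemma monic_op_block:
  assumes "weight (\<lambda>\<theta>. wt (cis \<theta>))"
  shows "monic_op (\<lambda>\<theta>. wt (cis \<theta>)) n (smult (1 / cnj (coeff C 0)) opoly)"
proof -
  have c0: "coeff C 0 \<noteq> 0" using nz(1)[of 0] by (simp add: poly_0_coeff_0)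
  have "coeff opoly k = 0" if "k > n" for k
    using that deg by (simp add: opoly_def coeff_rev_poly coeff_eq_0)
  moreover have n: "coeff opoly n = cnj (coeff C 0)"
    using deg coeff0 by (simp add: opoly_def coeff_rev_poly coeff_eq_0)
  ultimately have "degree opoly = n"
    using c0 by (intro antisym degree_le le_degree) auto
  moreover have "weighted_inner (\<lambda>\<theta>. wt (cis \<theta>)) opoly q = 0" if "q = 0 \<or> degree q < n" for q
    by (rule weighted_inner_lower_degree[OF assms opoly_orthogonal that])
  ultimately show ?thesis
    using c0 n by (simp add: monic_op_def weighted_inner_smult_left)
qed

text \<open>At z = 1 reversal is conjugation, so \<open>opoly\<close> takes the value Re C(1) - \<i>
  Im A(1) there.\<close>

lemma opoly_at_1: "Re (poly opoly 1) = Re (poly C 1)"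
  by (simp add: opoly_def rev_eq)

end

subsection \<open>Approximation of continuous weights\<close>

lemma norm_one_plus_power_minus_one_le:
  fixes x :: complex
  shows "cmod ((1 + x) ^ m - 1) \<le> exp (m * cmod x) - 1"
proof -
  have "cmod ((1 + x) ^ m - 1) \<le> (1 + cmod x) ^ m - 1"
  proof (induction m)
    case (Suc m)
    have "(1 + x) ^ Suc m - 1 = (1 + x) * ((1 + x) ^ m - 1) + x" by (simp add: algebra_simps)
    also have "cmod \<dots> \<le> cmod (1 + x) * cmod ((1 + x) ^ m - 1) + cmod x"
      by (metis norm_mult norm_triangle_ineq)
    also have "\<dots> \<le> (1 + cmod x) * ((1 + cmod x) ^ m - 1) + cmod x"
      using Suc norm_triangle_ineq[of 1 x] by (intro add_right_mono mult_mono) auto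
    finally show ?case by (simp add: algebra_simps)
  qed simp
  also have "(1 + cmod x) ^ m \<le> exp (cmod x) ^ m"
    by (intro power_mono) (auto simp: exp_ge_add_one_self)
  finally show ?thesis by (simp add: exp_of_nat_mult)
qed

text \<open>With y = x/M, the factor (1 + y) exp(-y) is 1 + d with \<bar>d\<bar> at most 7
  \<bar>y\<bar>^2. The constant 14 makes M \<bar>d\<bar> at most h/2, so the M-th power is within h
  of 1. The error is relative, however large exp x is.\<close>

lemma one_plus_power_exp:
  fixes x :: complex
  assumes "14 * (cmod x)\<^sup>2 \<le> M * h" "cmod x \<le> real M" "0 < h" "h \<le> 1" "0 < M"
  shows "\<exists>\<epsilon>. (1 + x / M) ^ M = exp x * (1 + \<epsilon>) \<and> cmod \<epsilon> \<le> h"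
proof -
  define y where "y = x / M"
  have y1: "cmod y \<le> 1" using assms by (simp add: y_def norm_divide)
  define r where "r = exp (- y) - (1 - y)"
  have r: "cmod r \<le> 3 * (cmod y)\<^sup>2"
  proof -
    have "cmod (exp (- y) - (\<Sum>k\<le>1. (- y) ^ k / fact k)) \<le> exp \<bar>Re (- y)\<bar> * (cmod (- y)) ^ Suc 1 / fact 1"
      by (rule Taylor_exp)
    also have "\<dots> = exp \<bar>Re y\<bar> * (cmod y)\<^sup>2" by (simp add: power2_eq_square)
    also have "\<dots> \<le> 3 * (cmod y)\<^sup>2"
    proof (rule mult_right_mono)
      have "exp \<bar>Re y\<bar> \<le> exp 1" using y1 abs_Re_le_cmod[of y] by simp
      then show "exp \<bar>Re y\<bar> \<le> 3" using exp_le by linarith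
    qed simp
    finally show ?thesis by (simp add: r_def)
  qed
  define d where "d = (1 + y) * exp (- y) - 1"
  have "d = - (y * y) + (1 + y) * r" by (simp add: d_def r_def algebra_simps)
  then have "cmod d \<le> cmod (y * y) + cmod ((1 + y) * r)"
    by (metis norm_minus_cancel norm_triangle_ineq)
  also have "\<dots> \<le> (cmod y)\<^sup>2 + 2 * (3 * (cmod y)\<^sup>2)"
    using norm_triangle_ineq[of 1 y] y1 r unfolding norm_mult power2_eq_square
    by (intro add_mono mult_mono) auto
  finally have d: "cmod d \<le> 7 * (cmod y)\<^sup>2" by simp
  have "real M * cmod d \<le> M * (7 * (cmod y)\<^sup>2)" by (intro mult_left_mono d) simp
  also have "\<dots> = 7 * (cmod x)\<^sup>2 / M"
    using assms(5) by (simp add: y_def norm_divide power2_eq_square)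
  also have "\<dots> \<le> h / 2" using assms by (simp add: field_simps)
  finally have Md: "real M * cmod d \<le> h / 2" .
  have "exp (M * cmod d) \<le> 1 + 2 * (M * cmod d)"
    using exp_bound_lemma[of "real M * cmod d"] Md assms by simp
  then have e: "cmod ((1 + d) ^ M - 1) \<le> h"
    using norm_one_plus_power_minus_one_le[of d M] Md by linarith
  have "(1 + d) ^ M = (1 + y) ^ M * exp (- x)"
    using assms(5) by (simp add: d_def power_mult_distrib y_def flip: exp_of_nat_mult)
  then have "(1 + y) ^ M = exp x * (1 + ((1 + d) ^ M - 1))"
    by (simp add: exp_minus field_simps)
  with e show ?thesis unfolding y_def by blast
qed

text \<open>Re p Re q is half of Re(p q) + Re(p cnj(q)). On the circle each term z^i cnj(z)^j is a
  power of z or the conjugate of one, and conjugating a term does not change its real part.\<close>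

lemma Re_mult_Re_poly_circle:
  fixes p q :: "complex poly"
  shows "\<exists>l. \<forall>z. cmod z = 1 \<longrightarrow> Re (poly p z) * Re (poly q z) = Re (poly l z)"
proof -
  define l where "l = (\<Sum>i\<le>degree p. \<Sum>j\<le>degree q.
    if j \<le> i then monom (coeff p i * cnj (coeff q j)) (i - j) else monom (cnj (coeff p i) * coeff q j) (j - i))"
  have "Re (poly p z * cnj (poly q z)) = Re (poly l z)" if z: "cmod z = 1" for z
  proof -
    have zz: "z * cnj z = 1" using z by (simp flip: complex_norm_square)
    have t: "Re (coeff p i * z ^ i * cnj (coeff q j * z ^ j)) =
      Re (poly (if j \<le> i then monom (coeff p i * cnj (coeff q j)) (i - j) else monom (cnj (coeff p i) * coeff q j) (j - i)) z)" for i j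
    proof (cases "j \<le> i")
      case True
      have "z ^ i * cnj z ^ j = z ^ (i - j) * (z * cnj z) ^ j"
        using True by (simp add: power_mult_distrib flip: power_add mult.assoc)
      then have "coeff p i * z ^ i * cnj (coeff q j * z ^ j) = coeff p i * cnj (coeff q j) * z ^ (i - j)"
        using zz by (simp add: mult_ac)
      then show ?thesis using True by (simp only: poly_monom if_True)
    next
      case False
      have "cnj z ^ i * z ^ j = z ^ (j - i) * (z * cnj z) ^ i"
        using False by (simp add: power_mult_distrib flip: power_add mult.assoc)
      then have "cnj (coeff p i * z ^ i * cnj (coeff q j * z ^ j)) = cnj (coeff p i) * coeff q j * z ^ (j - i)"
        using zz by (simp add: mult_ac)
      then have "Re (cnj (coeff p i * z ^ i * cnj (coeff q j * z ^ j))) = Re (cnj (coeff p i) * coeff q j * z ^ (j - i))"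
        by (simp only:)
      then show ?thesis using False by (simp only: cnj.sel poly_monom if_False)
    qed
    have "Re (poly p z * cnj (poly q z)) =
      (\<Sum>i\<le>degree p. \<Sum>j\<le>degree q. Re (coeff p i * z ^ i * cnj (coeff q j * z ^ j)))"
      unfolding poly_altdef cnj_sum sum_product Re_sum ..
    also have "\<dots> = Re (poly l z)"
      unfolding t l_def poly_sum Re_sum ..
    finally show ?thesis .
  qed
  then have "Re (poly p z) * Re (poly q z) = Re (poly (smult (1/2) (p * q + l)) z)" if "cmod z = 1" for z
    using that by (simp add: field_simps)
  then show ?thesis by blast
qed

text \<open>Links the Stone-Weierstrass theorem to analytic polynomials: real polynomials in Re z
  and Im z are trigonometric polynomials on the circle.\<close>

lemma real_polynomial_function_circle:
  fixes g :: "complex \<Rightarrow> real"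
  assumes "real_polynomial_function g"
  shows "\<exists>l. \<forall>z. cmod z = 1 \<longrightarrow> g z = Re (poly l z)"
  using assms
proof (induction rule: real_polynomial_function.induct)
  case (linear f)
  interpret bounded_linear f by fact
  have "f z = Re (poly [:0, f 1 - \<i> * f \<i>:] z)" for z
  proof -
    have "z = Re z *\<^sub>R 1 + Im z *\<^sub>R \<i>" by (simp add: complex_eq_iff)
    then have "f z = Re z * f 1 + Im z * f \<i>" by (metis add real_scaleR_def scaleR)
    then show ?thesis by simp
  qed
  then show ?case by blast
next
  case (const c)
  have "c = Re (poly [:of_real c:] z)" for z by simp
  then show ?case by blast
next
  case (add f g)
  then obtain p q where "\<forall>z. cmod z = 1 \<longrightarrow> f z = Re (poly p z)" "\<forall>z. cmod z = 1 \<longrightarrow> g z = Re (poly q z)"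
    by blast
  then have "\<forall>z. cmod z = 1 \<longrightarrow> f z + g z = Re (poly (p + q) z)" by simp
  then show ?case by blast
next
  case (mult f g)
  then obtain p q where "\<forall>z. cmod z = 1 \<longrightarrow> f z = Re (poly p z)" "\<forall>z. cmod z = 1 \<longrightarrow> g z = Re (poly q z)"
    by blast
  then show ?case using Re_mult_Re_poly_circle[of p q] by auto
qed

text \<open>Approximate ln W by -2 Re l with a polynomial l and take Q = (1 + l/M)^M, which is close
  to exp l, so that \<bar>Q\<bar>^-2 is close to W. A real value Q(1) is needed later to bound the
  orthogonal polynomial at 1 through its real part.\<close>

lemma inverse_poly_approx:
  assumes cont: "continuous_on (sphere 0 1) W" and pos: "\<And>z. cmod z = 1 \<Longrightarrow> 0 < W z"
    and \<eta>: "0 < \<eta>" "\<eta> \<le> 1"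
  shows "\<exists>Q :: complex poly. (\<forall>z. cmod z \<le> 1 \<longrightarrow> poly Q z \<noteq> 0) \<and> poly Q 1 \<in> \<real> \<and>
    (\<forall>z. cmod z = 1 \<longrightarrow> (1 - \<eta>) * W z \<le> 1 / (cmod (poly Q z))\<^sup>2 \<and> 1 / (cmod (poly Q z))\<^sup>2 \<le> (1 + \<eta>) * W z)"
proof -
  \<comment> \<open>The factor 8 leaves room for the error exp(h) in W and for the factor (1 + h)^2
    or (1 - h)^2 from replacing exp l by Q.\<close>
  define h where "h = \<eta> / 8"
  have h: "0 < h" "h \<le> 1 / 8" "\<eta> = 8 * h" using \<eta> by (auto simp: h_def)
  have "continuous_on (sphere 0 1) (\<lambda>z. ln (W z))"
    using cont pos by (intro continuous_intros) (auto simp: less_imp_neq[symmetric])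
  then obtain g where g: "real_polynomial_function g" "\<And>z. z \<in> sphere 0 1 \<Longrightarrow> \<bar>ln (W z) - g z\<bar> < h"
    using Stone_Weierstrass_real_polynomial_function[of "sphere 0 1" "\<lambda>z. ln (W z)" h] h by auto
  obtain l0 where l0: "\<And>z. cmod z = 1 \<Longrightarrow> g z = Re (poly l0 z)"
    using real_polynomial_function_circle[OF g(1)] by blast
  \<comment> \<open>Subtracting an imaginary constant leaves Re l0 unchanged and makes l(1)
    real.\<close>
  define l where "l = smult (- 1/2) (l0 - [:\<i> * Im (poly l0 1):])"
  have l: "\<bar>ln (W z) + 2 * Re (poly l z)\<bar> < h" if "cmod z = 1" for z
    using g(2)[of z] l0[of z] that by (simp add: l_def)
  have l1: "poly l 1 \<in> \<real>" by (simp add: l_def complex_is_Real_iff)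
  have "compact (poly l ` cball 0 1)" by (intro compact_continuous_image continuous_intros) auto
  then obtain B where "\<And>z. z \<in> cball 0 1 \<Longrightarrow> cmod (poly l z) \<le> B"
    by (meson bounded_iff compact_imp_bounded imageI)
  then have B: "\<And>z. cmod z \<le> 1 \<Longrightarrow> cmod (poly l z) \<le> B" by auto
  have B0: "0 \<le> B" using B[of 0] norm_ge_zero[of "poly l 0"] by (simp del: norm_ge_zero)
  \<comment> \<open>The first bound gives relative accuracy h; the second makes \<bar>l\<bar> < M on
    the disc, so Q has no zero there.\<close>
  obtain M :: nat where M: "real M > max (14 * B\<^sup>2 / h) (max B 0)" using reals_Archimedean2 by blast
  then have M': "14 * B\<^sup>2 \<le> M * h" "B < M" "0 < M" using h by (auto simp: field_simps)
  define Q where "Q = (1 + smult (1 / M) l) ^ M"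
  have Qz: "poly Q z = (1 + poly l z / M) ^ M" for z by (simp add: Q_def)
  have "poly Q z \<noteq> 0" if "cmod z \<le> 1" for z
  proof
    assume "poly Q z = 0"
    then have "1 + poly l z / M = 0" using M'(3) by (simp add: Qz)
    then have "poly l z = - M" using M'(3) by (simp add: field_simps add_eq_0_iff)
    then show False using B[OF that] M'(2) by simp
  qed
  moreover have "poly Q 1 \<in> \<real>" using l1 by (auto simp: Qz intro!: Reals_power Reals_add Reals_divide)
  moreover have "(1 - \<eta>) * W z \<le> 1 / (cmod (poly Q z))\<^sup>2 \<and> 1 / (cmod (poly Q z))\<^sup>2 \<le> (1 + \<eta>) * W z"
    if z: "cmod z = 1" for z
  proof -
    have "14 * (cmod (poly l z))\<^sup>2 \<le> M * h"
      using B[of z] z M'(1) by (smt (verit, best) norm_ge_zero power_mono)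
    then obtain \<epsilon> where \<epsilon>: "poly Q z = exp (poly l z) * (1 + \<epsilon>)" "cmod \<epsilon> \<le> h"
      using one_plus_power_exp[of "poly l z" M h] B[of z] z M'(2,3) h by (auto simp: Qz)
    define a where "a = cmod (1 + \<epsilon>)"
    have a: "1 - h \<le> a" "a \<le> 1 + h"
      using \<epsilon>(2) norm_triangle_ineq[of 1 \<epsilon>] norm_triangle_ineq2[of 1 "- \<epsilon>"] by (auto simp: a_def)
    define t where "t = exp (- 2 * Re (poly l z) - ln (W z))"
    have eq: "1 / (cmod (poly Q z))\<^sup>2 = W z * (t / a\<^sup>2)"
    proof -
      have "(exp (Re (poly l z)))\<^sup>2 = exp (2 * Re (poly l z))" by (simp add: exp_double)
      then have "1 / (cmod (poly Q z))\<^sup>2 = exp (- 2 * Re (poly l z)) / a\<^sup>2"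
        by (simp add: \<epsilon>(1) norm_mult a_def power_mult_distrib exp_minus divide_simps)
      moreover have "W z * t = exp (- 2 * Re (poly l z))"
        using pos[OF z] by (simp add: t_def exp_diff)
      ultimately show ?thesis by simp
    qed
    have "t \<le> exp h" using l[OF z] by (simp add: t_def)
    also have "exp h \<le> 1 + h + h\<^sup>2" using h by (intro exp_bound) auto
    finally have t1: "t \<le> 1 + h + h\<^sup>2" .
    have "exp (- h) \<le> t" using l[OF z] by (simp add: t_def)
    then have t2: "1 - h \<le> t" using exp_ge_add_one_self[of "- h"] by linarith
    have ap: "0 < a" using a h by simp
    have "t \<le> (1 + 8 * h) * a\<^sup>2"
    proof -
      have "1 + h + h\<^sup>2 \<le> (1 + 8 * h) * (1 - h)\<^sup>2"
      proof -
        have "(1 + 8 * h) * (1 - h)\<^sup>2 - (1 + h + h\<^sup>2) = h * (5 - 16 * h) + 8 * h ^ 3"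
          by (simp add: algebra_simps power2_eq_square power3_eq_cube)
        moreover have "0 \<le> h * (5 - 16 * h) + 8 * h ^ 3"
          using h by (intro add_nonneg_nonneg mult_nonneg_nonneg) auto
        ultimately show ?thesis by linarith
      qed
      also have "\<dots> \<le> (1 + 8 * h) * a\<^sup>2"
        using a h by (intro mult_left_mono power_mono) auto
      finally show ?thesis using t1 by linarith
    qed
    then have u: "t / a\<^sup>2 \<le> 1 + \<eta>" using ap h(3) by (simp add: divide_le_eq)
    have "(1 - 8 * h) * a\<^sup>2 \<le> t"
    proof -
      have "(1 - 8 * h) * a\<^sup>2 \<le> (1 - 8 * h) * (1 + h)\<^sup>2"
        using a ap h by (intro mult_left_mono power_mono) auto
      also have "\<dots> = 1 - h - h * (5 + 15 * h + 8 * h\<^sup>2)"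
        by (simp add: algebra_simps power2_eq_square power3_eq_cube)
      also have "\<dots> \<le> 1 - h" using h by simp
      finally show ?thesis using t2 by linarith
    qed
    then have lo: "1 - \<eta> \<le> t / a\<^sup>2" using ap h(3) by (simp add: le_divide_eq)
    show ?thesis
      unfolding eq mult.commute[of _ "W z"] using u lo pos[OF z]
      by (intro conjI mult_left_mono) auto
  qed
  ultimately show ?thesis by blast
qed

subsection \<open>A localized block of growth\<close>

text \<open>The truncated logarithm of \<open>(1 - \<rho>z) / (1 - rz)\<close>, where \<open>1 - \<rho> = s\<close> is the scale of
  localization and \<open>1 - r = 1/m\<close> the scale at which the singularity is smoothed out.\<close>

definition log_poly :: "real \<Rightarrow> nat \<Rightarrow> nat \<Rightarrow> complex poly" where
  "log_poly s m j = (\<Sum>k<Suc (j * m). monom (of_real (((1 - 1 / m) ^ k - (1 - s) ^ k) / k)) k)"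

lemma degree_log_poly: "degree (log_poly s m j) \<le> j * m"
  unfolding log_poly_def by (intro degree_sum_le) (auto intro: order_trans[OF degree_monom_le])

text \<open>The term for k = 0 has numerator 0, and division by 0 yields 0. This is what gives C(0)
  = A(0) in the block.\<close>

lemma coeff_log_poly_0: "coeff (log_poly s m j) 0 = 0"
  by (simp add: log_poly_def coeff_sum)

context
  fixes s :: real and m j :: nat and r \<rho> :: real
  assumes s: "0 < s" "s < 1" and m: "1 < m" "1 / m < s" and j: "0 < j"
    and r: "r = 1 - 1 / m" and \<rho>: "\<rho> = 1 - s"
begin

private lemma rr: "0 < \<rho>" "\<rho> < r" "0 < r" "r < 1" "\<rho> < 1" "1 / (1 - r) = m"
  using s m by (auto simp: r \<rho>)

private lemma poly_log_poly: "poly (log_poly s m j) z = (\<Sum>k<Suc (j * m). of_real ((r ^ k - \<rho> ^ k) / k) * z ^ k)"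
  unfolding log_poly_def poly_sum poly_monom r \<rho> ..

private lemma coeff_pos: "0 \<le> (r ^ k - \<rho> ^ k) / k"
  using rr by (simp add: power_mono)

private lemma norm_coeff: "cmod (of_real ((r ^ k - \<rho> ^ k) / k)) = (r ^ k - \<rho> ^ k) / k"
  by (simp only: norm_of_real abs_of_nonneg coeff_pos)

lemma poly_log_poly_1:
  "poly (log_poly s m j) 1 = of_real (\<Sum>k<Suc (j * m). (r ^ k - \<rho> ^ k) / k)"
  unfolding poly_log_poly by simp

lemma log_poly_1_real: "poly (log_poly s m j) 1 = of_real (Re (poly (log_poly s m j) 1))"
  unfolding poly_log_poly_1 by simp

text \<open>All coefficients are nonnegative since \<rho> < r, so the modulus on the disc is largest
  at 1.\<close>

lemma norm_log_poly_le:
  fixes z :: complex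
  assumes "cmod z \<le> 1"
  shows "cmod (poly (log_poly s m j) z) \<le> Re (poly (log_poly s m j) 1)"
proof -
  have "cmod (poly (log_poly s m j) z) \<le> (\<Sum>k<Suc (j * m). cmod (of_real ((r ^ k - \<rho> ^ k) / k) * z ^ k))"
    unfolding poly_log_poly by (rule norm_sum)
  also have "\<dots> \<le> (\<Sum>k<Suc (j * m). (r ^ k - \<rho> ^ k) / k * 1)"
    unfolding norm_mult norm_power norm_coeff using coeff_pos assms
    by (intro sum_mono mult_mono power_le_one) auto
  finally show ?thesis unfolding poly_log_poly_1 by simp
qed

text \<open>Beyond degree j m the coefficients are dominated by r^k / (j m), and the geometric
  series of ratio r sums to m.\<close>

lemma log_poly_approx:
  fixes z :: complex
  assumes "cmod z \<le> 1"
  shows "cmod (poly (log_poly s m j) z - (Ln (1 - \<rho> * z) - Ln (1 - r * z))) \<le> 1 / j"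
proof -
  define f where "f k = complex_of_real ((r ^ k - \<rho> ^ k) / k) * z ^ k" for k :: nat
  have lt: "cmod (- (complex_of_real r * z)) < 1" "cmod (- (complex_of_real \<rho> * z)) < 1"
    using rr assms by (auto simp: norm_mult intro: le_less_trans[OF mult_left_le])
  have "f = (\<lambda>n. - ((- (- (\<rho> * z))) ^ n) / of_nat n - - ((- (- (r * z))) ^ n) / of_nat n)"
    by (rule ext) (simp add: f_def power_mult_distrib diff_divide_distrib left_diff_distrib)
  moreover have "(\<lambda>n. - ((- (- (\<rho> * z))) ^ n) / of_nat n - - ((- (- (r * z))) ^ n) / of_nat n)
    sums (Ln (1 + - (\<rho> * z)) - Ln (1 + - (r * z)))"
    by (intro sums_diff Ln_series' lt)
  ultimately have "f sums (Ln (1 - \<rho> * z) - Ln (1 - r * z))" by simp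
  then have tail: "(\<lambda>k. f (k + Suc (j * m))) sums (Ln (1 - \<rho> * z) - Ln (1 - r * z) - (\<Sum>k<Suc (j * m). f k))"
    by (rule sums_split_initial_segment)
  have le: "cmod (f (k + Suc (j * m))) \<le> r ^ k / (j * m)" for k
  proof -
    let ?k = "k + Suc (j * m)"
    have "cmod (f ?k) \<le> (r ^ ?k - \<rho> ^ ?k) / ?k * 1"
      unfolding f_def norm_mult norm_power norm_coeff using coeff_pos[of ?k] assms
      by (intro mult_mono power_le_one) auto
    also have "\<dots> \<le> r ^ k / (j * m)"
    proof -
      have "r ^ ?k \<le> r ^ k" using rr by (intro power_decreasing) auto
      moreover have "0 \<le> \<rho> ^ ?k" using rr by simp
      ultimately have "r ^ ?k - \<rho> ^ ?k \<le> r ^ k" by linarith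
      moreover have "real (j * m) \<le> ?k" by simp
      ultimately show ?thesis using j m rr unfolding mult_1_right
        by (intro frac_le) auto
    qed
    finally show ?thesis .
  qed
  have geo: "(\<lambda>k. r ^ k / (j * m)) sums (1 / (1 - r) / (j * m))"
    using rr by (intro sums_divide geometric_sums) auto
  have "cmod (Ln (1 - \<rho> * z) - Ln (1 - r * z) - (\<Sum>k<Suc (j * m). f k)) \<le> 1 / (1 - r) / (j * m)"
    using norm_suminf_le[of "\<lambda>k. f (k + Suc (j * m))" "\<lambda>k. r ^ k / (j * m)"] le tail geo
    by (simp add: sums_iff)
  also have "\<dots> = 1 / j" using rr(6) m by simp
  finally show ?thesis unfolding poly_log_poly f_def by (simp add: norm_minus_commute)
qed

text \<open>Above: drop the \<rho> terms and compare with the series of -ln(1 - r) = ln m. Below: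
  the full logarithm at 1 is ln(s m), and truncation costs at most 1/j.\<close>

lemma log_poly_1_bounds:
  "Re (poly (log_poly s m j) 1) \<le> ln m" "ln (s * m) - 1 / j \<le> Re (poly (log_poly s m j) 1)"
proof -
  have r1: "1 - complex_of_real r = of_real (1 / m)" "1 - complex_of_real \<rho> = of_real s"
    by (simp_all add: r \<rho>)
  have "Ln (1 - complex_of_real \<rho>) - Ln (1 - complex_of_real r) = of_real (ln (s * m))"
    unfolding r1 using s m by (simp add: Ln_of_real ln_mult ln_div del: of_real_divide of_real_1)
  then have "cmod (poly (log_poly s m j) 1 - of_real (ln (s * m))) \<le> 1 / j"
    using log_poly_approx[of 1] by simp
  moreover have "Re (of_real (ln (s * m)) - poly (log_poly s m j) 1) \<le> cmod (poly (log_poly s m j) 1 - of_real (ln (s * m)))"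
    by (metis complex_Re_le_cmod norm_minus_commute)
  ultimately show "ln (s * m) - 1 / j \<le> Re (poly (log_poly s m j) 1)" by simp
  have "(\<lambda>n. - ((- (- r)) ^ n) / of_nat n) sums ln (1 + - r)"
    using rr by (intro ln_series') auto
  then have "(\<lambda>n. r ^ n / n) sums (- ln (1 + - r))"
    using sums_minus by fastforce
  then have "(\<lambda>n. r ^ n / n) sums ln m"
    using m by (simp add: r ln_div)
  then have "(\<Sum>k<Suc (j * m). r ^ k / k) \<le> ln m"
    using sum_le_suminf[of "\<lambda>n. r ^ n / n" "{..<Suc (j * m)}"] rr by (auto simp: sums_iff)
  moreover have "(\<Sum>k<Suc (j * m). (r ^ k - \<rho> ^ k) / k) \<le> (\<Sum>k<Suc (j * m). r ^ k / k)"
    using rr by (intro sum_mono divide_right_mono) auto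
  ultimately show "Re (poly (log_poly s m j) 1) \<le> ln m"
    unfolding poly_log_poly_1 by simp
qed

text \<open>Both 1 - \<rho>z and 1 - rz lie in the right half-plane with arguments of the same sign,
  opposite to Im z. So the difference stays below pi/2 instead of pi, which is what admits every
  \<gamma> < 1/2.\<close>

private lemma Im_Ln_diff:
  fixes z :: complex
  assumes "cmod z = 1"
  shows "\<bar>Im (Ln (1 - \<rho> * z) - Ln (1 - r * z))\<bar> < pi / 2"
proof -
  have Re: "0 < Re (1 - of_real x * z)" if "0 < x" "x < 1" for x :: real
  proof -
    have "x * Re z \<le> x * 1" using that assms complex_Re_le_cmod[of z] by (intro mult_left_mono) auto
    then have "x * Re z < 1" using that by linarith
    then show ?thesis by simp
  qed
  have nz: "1 - of_real x * z \<noteq> 0" if "0 < x" "x < 1" for x :: real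
    using Re[OF that] by (metis less_irrefl zero_complex.sel(1))
  have lt: "\<bar>Im (Ln (1 - of_real x * z))\<bar> < pi / 2" if "0 < x" "x < 1" for x :: real
    using Re[OF that] Re_Ln_pos_lt[OF nz[OF that]] by simp
  have sign: "0 \<le> Im (Ln (1 - of_real x * z)) \<longleftrightarrow> Im z \<le> 0" if "0 < x" "x < 1" for x :: real
  proof -
    have "0 \<le> Im (Ln (1 - of_real x * z)) \<longleftrightarrow> 0 \<le> Im (1 - of_real x * z)"
      using Im_Ln_pos_le[OF nz[OF that]] lt[OF that] pi_gt_zero Re[OF that] by linarith
    then show ?thesis using that by (simp add: mult_le_0_iff)
  qed
  show ?thesis
    using lt[OF rr(3,4)] lt[OF rr(1,5)] sign[OF rr(3,4)] sign[OF rr(1,5)]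
    unfolding minus_complex.sel by (cases "Im z \<le> 0") linarith+
qed

lemma Im_log_poly:
  fixes z :: complex
  assumes "cmod z = 1"
  shows "\<bar>Im (poly (log_poly s m j) z)\<bar> \<le> pi / 2 + 1 / j"
proof -
  have "\<bar>Im (poly (log_poly s m j) z - (Ln (1 - \<rho> * z) - Ln (1 - r * z)))\<bar> \<le> 1 / j"
    using log_poly_approx[of z] assms by (intro order_trans[OF abs_Im_le_cmod]) simp
  then show ?thesis using Im_Ln_diff[OF assms] unfolding minus_complex.sel by linarith
qed

text \<open>Away from 1 the quotient (1 - \<rho>z) / (1 - rz) is 1 + u with \<bar>u\<bar> at most 2
  s / \<sigma>, hence its logarithm is small.\<close>

lemma log_poly_far:
  fixes z :: complex
  assumes "cmod z = 1" "\<sigma> \<le> cmod (z - 1)" "8 * s \<le> \<sigma>"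
  shows "cmod (poly (log_poly s m j) z) \<le> 4 * s / \<sigma> + 1 / j"
proof -
  have \<sigma>: "0 < \<sigma>" using assms s by linarith
  \<comment> \<open>Since 1 - r is itself at most \<bar>1 - rz\<bar>, this decomposition gives
    \<bar>z - 1\<bar> at most 2 \<bar>1 - rz\<bar>.\<close>
  have "z - 1 = - (1 - r * z) + of_real (1 - r) * z" by (simp add: algebra_simps)
  then have "cmod (z - 1) \<le> cmod (1 - r * z) + cmod (of_real (1 - r) * z)"
    by (metis norm_minus_cancel norm_triangle_ineq)
  also have "cmod (of_real (1 - r) * z) = 1 - r" unfolding norm_mult norm_of_real using rr assms by simp
  also have "1 - r \<le> cmod (1 - r * z)"
    using norm_triangle_ineq2[of 1 "r * z"] rr assms by (simp add: norm_mult)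
  finally have d: "\<sigma> / 2 \<le> cmod (1 - r * z)" using assms(2) by simp
  then have nz: "1 - of_real r * z \<noteq> 0" using \<sigma> by auto
  have nz': "1 - of_real \<rho> * z \<noteq> 0"
  proof
    assume "1 - of_real \<rho> * z = 0"
    then have "cmod (of_real \<rho> * z) = 1" by simp
    then show False using rr assms by (simp add: norm_mult)
  qed
  define u where "u = of_real (r - \<rho>) * z / (1 - r * z)"
  have "cmod u = (r - \<rho>) / cmod (1 - r * z)"
    using rr assms by (simp add: u_def norm_divide norm_mult flip: of_real_diff)
  also have "\<dots> \<le> s / (\<sigma> / 2)" using d rr s \<sigma> m by (intro frac_le) (auto simp: r \<rho>)
  finally have u: "cmod u \<le> 2 * s / \<sigma>" by (simp add: mult.commute)
  also have "\<dots> \<le> 1 / 4" using assms(3) \<sigma> by (simp add: field_simps)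
  finally have u2: "cmod u \<le> 1 / 4" .
  have "exp (Ln (1 - \<rho> * z) - Ln (1 - r * z)) = 1 + u"
    using nz nz' by (simp add: exp_diff u_def field_simps)
  moreover have "Ln (exp (Ln (1 - \<rho> * z) - Ln (1 - r * z))) = Ln (1 - \<rho> * z) - Ln (1 - r * z)"
    using Im_Ln_diff[OF assms(1)] pi_gt_zero by (intro Ln_exp) linarith+
  ultimately have "cmod (Ln (1 - \<rho> * z) - Ln (1 - r * z)) \<le> 2 * cmod u"
    using norm_Ln_le[of u] u2 by simp
  then have "cmod (Ln (1 - \<rho> * z) - Ln (1 - r * z)) \<le> 4 * s / \<sigma>" using u by simp
  moreover have "cmod (poly (log_poly s m j) z) \<le> cmod (poly (log_poly s m j) z - (Ln (1 - \<rho> * z) - Ln (1 - r * z)))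
     + cmod (Ln (1 - \<rho> * z) - Ln (1 - r * z))"
    by (metis diff_add_cancel norm_triangle_ineq)
  ultimately show ?thesis using log_poly_approx[of z] assms by simp
qed

end

section \<open>Size estimates for one block and its assembly\<close>

lemma quasilinear_powr_le:
  fixes \<gamma> \<gamma>' a b c D :: real
  assumes "0 < \<gamma>'" "\<gamma>' < \<gamma>" "0 < c" "0 < D" "0 \<le> a" "0 \<le> b" "0 < j"
  shows "\<forall>\<^sub>F m in sequentially. D * (b + j * real m * (a * (ln (real m))\<^sup>2 + ln (real m) + 3)) powr \<gamma>' \<le> c * real m powr \<gamma>"
proof -
  define \<beta> where "\<beta> = \<gamma> / \<gamma>'"
  have \<beta>: "\<beta> > 1" using assms by (simp add: \<beta>_def)
  define \<kappa> where "\<kappa> = (c / D) powr (1 / \<gamma>')"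
  have \<kappa>: "0 < \<kappa>" using assms by (simp add: \<kappa>_def)
  \<comment> \<open>The degree of the block is m times a power of ln m; the gap between \<gamma>'
    and \<gamma> makes the exponent \<open>\<beta>\<close> exceed 1, which absorbs logarithms and
    constants.\<close>
  have "(\<lambda>m::nat. (b + j * real m * (a * (ln (real m))\<^sup>2 + ln (real m) + 3)) / real m powr \<beta>) \<longlonglongrightarrow> 0"
    using \<beta> by real_asymp
  then have "\<forall>\<^sub>F m::nat in sequentially. (b + j * real m * (a * (ln (real m))\<^sup>2 + ln (real m) + 3)) / real m powr \<beta> < \<kappa>"
    using \<kappa> by (rule order_tendstoD)
  then show ?thesis
    using eventually_gt_at_top[of 1]
  proof eventually_elim
    case (elim m)
    let ?x = "b + j * real m * (a * (ln (real m))\<^sup>2 + ln (real m) + 3)"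
    have "0 \<le> ?x" using assms elim by (intro add_nonneg_nonneg mult_nonneg_nonneg) auto
    have "?x \<le> \<kappa> * real m powr \<beta>" using elim by (simp add: divide_less_eq)
    then have "?x powr \<gamma>' \<le> (\<kappa> * real m powr \<beta>) powr \<gamma>'"
      using \<open>0 \<le> ?x\<close> assms by (intro powr_mono2) auto
    also have "\<dots> = (c / D) * real m powr \<gamma>"
      using assms by (simp add: powr_mult \<kappa>_def \<beta>_def powr_powr)
    finally show ?case using assms by (simp add: field_simps)
  qed
qed

text \<open>1 - cos x = 2 sin(x/2)^2 is at most 2 \<bar>sin(x/2)\<bar>, hence at most x.\<close>

lemma one_minus_le_cos:
  fixes x :: real
  assumes "0 \<le> x"
  shows "1 - x \<le> cos x"
proof -
  have "1 - cos (2 * (x / 2)) = 2 * (sin (x / 2))\<^sup>2" by (subst cos_double_sin) simp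
  also have "(sin (x / 2))\<^sup>2 \<le> \<bar>sin (x / 2)\<bar> * 1"
    unfolding power2_eq_square by (subst abs_mult_self_eq[symmetric]) (intro mult_left_mono; simp)
  also have "\<dots> \<le> x / 2" using abs_sin_x_le_abs_x[of "x / 2"] assms by simp
  finally show ?thesis by simp
qed

lemma mult_one_plus_small:
  fixes x y :: complex
  assumes "cmod x \<le> h" "cmod y \<le> h" "h \<le> 1"
  shows "\<exists>\<zeta>. (1 + x) * (1 + y) = 1 + \<zeta> \<and> cmod \<zeta> \<le> 3 * h"
proof (intro exI[of _ "x + y + x * y"] conjI)
  have "cmod (x + y + x * y) \<le> cmod x + cmod y + cmod x * cmod y"
    by (metis norm_mult norm_triangle_ineq order_trans add_right_mono)
  also have "cmod x * cmod y \<le> 1 * h" using assms by (intro mult_mono) auto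
  finally show "cmod (x + y + x * y) \<le> 3 * h" using assms by linarith
qed (simp add: algebra_simps)

text \<open>In C cnj(A) the moduli of the exponentials cancel and only the phase 2 Im L survives; in
  C A they cancel entirely. So a large Re L is invisible to the weight.\<close>

lemma block_products:
  fixes Q L :: complex
  assumes C: "C = Q * exp L * (1 + x)" and A: "A = Q * exp (- L) * (1 + y)"
    and h: "cmod x \<le> h" "cmod y \<le> h" "h \<le> 1"
  shows "\<exists>\<zeta>. C * cnj A = (cmod Q)\<^sup>2 * (cis (2 * Im L) + \<zeta>) \<and> cmod \<zeta> \<le> 3 * h"
    and "\<exists>\<zeta>. C * A = Q\<^sup>2 * (1 + \<zeta>) \<and> cmod \<zeta> \<le> 3 * h"
proof -
  obtain \<zeta> where \<zeta>: "(1 + x) * (1 + cnj y) = 1 + \<zeta>" "cmod \<zeta> \<le> 3 * h"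
    using mult_one_plus_small[of x h "cnj y"] h by auto
  have "exp L * exp (- cnj L) = cis (2 * Im L)"
    unfolding cis_conv_exp exp_add[symmetric] by (rule arg_cong[of _ _ exp]) (simp add: complex_eq_iff)
  then have "C * cnj A = (Q * cnj Q) * (cis (2 * Im L) * ((1 + x) * (1 + cnj y)))"
    by (simp add: C A exp_cnj mult_ac)
  also have "\<dots> = (cmod Q)\<^sup>2 * (cis (2 * Im L) + cis (2 * Im L) * \<zeta>)"
    unfolding \<zeta>(1) complex_norm_square[symmetric] by (simp add: algebra_simps)
  finally show "\<exists>\<zeta>. C * cnj A = (cmod Q)\<^sup>2 * (cis (2 * Im L) + \<zeta>) \<and> cmod \<zeta> \<le> 3 * h"
    using \<zeta>(2) by (metis mult_1 norm_cis norm_mult)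
  obtain \<zeta> where \<zeta>: "(1 + x) * (1 + y) = 1 + \<zeta>" "cmod \<zeta> \<le> 3 * h"
    using mult_one_plus_small[of x h y] h by auto
  have "C * A = Q\<^sup>2 * (exp L * exp (- L)) * ((1 + x) * (1 + y))"
    by (simp add: C A power2_eq_square mult_ac)
  also have "exp L * exp (- L) = 1" by (simp flip: exp_add)
  finally show "\<exists>\<zeta>. C * A = Q\<^sup>2 * (1 + \<zeta>) \<and> cmod \<zeta> \<le> 3 * h"
    using \<zeta> by auto
qed

text \<open>After scaling by q = \<bar>Q\<bar>^2, the numerator is cos \<tau> up to 3 h, and
  \<bar>E\<bar> lies within \<bar>sin \<tau>\<bar> + 6 h of 1: each of the two products contributes
  3 h.\<close>

lemma (in op_block) wt_bounds:
  assumes z: "cmod z = 1" and Q: "Q \<noteq> 0"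
    and CA: "poly C z * cnj (poly A z) = (cmod Q)\<^sup>2 * (cis \<tau> + \<zeta>)" "cmod \<zeta> \<le> 3 * h"
    and CA': "poly C z * poly A z = Q\<^sup>2 * (1 + \<xi>)" "cmod \<xi> \<le> 3 * h"
    and b: "\<bar>sin \<tau>\<bar> \<le> S" "c \<le> cos \<tau>" "cos \<tau> \<le> 1" "3 * h < c" "S + 6 * h < 1"
  shows "(c - 3 * h) / (1 + S + 6 * h)\<^sup>2 \<le> (cmod Q)\<^sup>2 * wt z"
    and "(cmod Q)\<^sup>2 * wt z \<le> (1 + 3 * h) / (1 - S - 6 * h)\<^sup>2"
proof -
  define q where "q = (cmod Q)\<^sup>2"
  have q: "0 < q" using Q by (simp add: q_def)
  have h0: "0 \<le> h" using CA(2) norm_ge_zero[of \<zeta>] by linarith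
  define R where "R = cos \<tau> + Re \<zeta>"
  define I where "I = sin \<tau> + Im \<zeta>"
  have RI: "Re (poly C z * cnj (poly A z)) = q * R" "Im (poly C z * cnj (poly A z)) = q * I"
    unfolding CA R_def I_def q_def by simp_all
  have R: "c - 3 * h \<le> R" "R \<le> 1 + 3 * h"
    using b CA(2) abs_Re_le_cmod[of \<zeta>] unfolding R_def by linarith+
  have I: "\<bar>I\<bar> \<le> S + 3 * h"
    using b CA(2) abs_Im_le_cmod[of \<zeta>] unfolding I_def by linarith
  define e where "e = cmod (poly E z) / q"
  have E: "poly E z = Q\<^sup>2 * (1 + \<xi>) - \<i> * z ^ n * (q * I)"
    using E_circle[OF z] unfolding RI CA' by simp
  have nI: "cmod (\<i> * z ^ n * (q * I)) = q * \<bar>I\<bar>"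
    using z q by (simp add: norm_mult norm_power)
  have nQ: "cmod (Q\<^sup>2 * (1 + \<xi>)) = q * cmod (1 + \<xi>)"
    by (simp add: norm_mult norm_power q_def)
  have "cmod (1 + \<xi>) \<le> 1 + 3 * h" "1 - 3 * h \<le> cmod (1 + \<xi>)"
    using CA'(2) norm_triangle_ineq[of 1 \<xi>] norm_triangle_ineq2[of 1 "- \<xi>"] by auto
  then have "q * (cmod (1 + \<xi>) + \<bar>I\<bar>) \<le> q * (1 + S + 6 * h)" "q * (1 - S - 6 * h) \<le> q * (cmod (1 + \<xi>) - \<bar>I\<bar>)"
    using I q by (intro mult_left_mono; simp)+
  moreover have "cmod (poly E z) \<le> q * cmod (1 + \<xi>) + q * \<bar>I\<bar>" "q * cmod (1 + \<xi>) - q * \<bar>I\<bar> \<le> cmod (poly E z)"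
    using norm_triangle_ineq4[of "Q\<^sup>2 * (1 + \<xi>)" "\<i> * z ^ n * (q * I)"]
      norm_triangle_ineq2[of "Q\<^sup>2 * (1 + \<xi>)" "\<i> * z ^ n * (q * I)"]
    unfolding E nI nQ by auto
  ultimately have "cmod (poly E z) \<le> q * (1 + S + 6 * h)" "q * (1 - S - 6 * h) \<le> cmod (poly E z)"
    by (simp_all add: distrib_left right_diff_distrib)
  then have e: "e \<le> 1 + S + 6 * h" "1 - S - 6 * h \<le> e"
    using q by (simp_all add: e_def divide_le_eq le_divide_eq mult.commute)
  have "q * wt z = R / e\<^sup>2"
    using q by (simp add: wt_def RI[simplified] e_def power_divide power2_eq_square)
  then have w: "(cmod Q)\<^sup>2 * wt z = R / e\<^sup>2" by (simp add: q_def)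
  have e0: "0 < e" using e b by linarith
  show "(c - 3 * h) / (1 + S + 6 * h)\<^sup>2 \<le> (cmod Q)\<^sup>2 * wt z"
    unfolding w using R e e0 b by (intro frac_le power_mono) auto
  show "(cmod Q)\<^sup>2 * wt z \<le> (1 + 3 * h) / (1 - S - 6 * h)\<^sup>2"
    unfolding w using R e e0 b h0 by (intro frac_le power_mono) auto
qed

text \<open>C and A approximate Q exp(L) and Q exp(-L) with L equal to \<gamma> times the truncated
  logarithm. The phase 2 Im L is at most pi \<gamma> + h everywhere and at most 2 h where \<bar>z -
  1\<bar> is at least \<sigma>, whence the two pairs of bounds. \<open>D\<close> leaves room for
  later constant losses.\<close>

lemma growth_block:
  fixes \<gamma> \<gamma>' h \<sigma> D :: real and Q :: "complex poly" and N :: nat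
  assumes \<gamma>: "0 < \<gamma>'" "\<gamma>' < \<gamma>" "\<gamma> < 1 / 2" and h: "0 < h" "h \<le> 1 / 16"
    and h': "pi * \<gamma> + h < pi / 2" "3 * h < cos (pi * \<gamma> + h)" "sin (pi * \<gamma> + h) + 6 * h < 1"
    and \<sigma>: "0 < \<sigma>" and Q: "\<And>z. cmod z \<le> 1 \<Longrightarrow> poly Q z \<noteq> 0" "poly Q 1 \<in> \<real>"
    and D: "0 < D"
  shows "\<exists>n W P. N < n \<and> continuous_on (sphere 0 1) W \<and>
    (weight (\<lambda>\<theta>. W (cis \<theta>)) \<longrightarrow> monic_op (\<lambda>\<theta>. W (cis \<theta>)) n P) \<and>
    D * real n powr \<gamma>' \<le> cmod (poly P 1) \<and>
    (\<forall>z. cmod z = 1 \<longrightarrow>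
      (cos (pi * \<gamma> + h) - 3 * h) / (1 + sin (pi * \<gamma> + h) + 6 * h)\<^sup>2 \<le> (cmod (poly Q z))\<^sup>2 * W z \<and>
      (cmod (poly Q z))\<^sup>2 * W z \<le> (1 + 3 * h) / (1 - sin (pi * \<gamma> + h) - 6 * h)\<^sup>2) \<and>
    (\<forall>z. cmod z = 1 \<longrightarrow> \<sigma> \<le> cmod (z - 1) \<longrightarrow>
      (1 - 5 * h) / (1 + 8 * h)\<^sup>2 \<le> (cmod (poly Q z))\<^sup>2 * W z \<and>
      (cmod (poly Q z))\<^sup>2 * W z \<le> (1 + 3 * h) / (1 - 8 * h)\<^sup>2)"
proof -
  \<comment> \<open>Chosen so that 4 s / \<sigma> is at most h/2; the other half of h is left for
    the truncation error 1/j.\<close>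
  define s where "s = min (1/2) (h * \<sigma> / 8)"
  have s: "0 < s" "s < 1" "8 * s \<le> h * \<sigma>" using h \<sigma> by (auto simp: s_def)
  have "h * \<sigma> \<le> 1 * \<sigma>" using h \<sigma> by (intro mult_right_mono) auto
  then have s': "8 * s \<le> \<sigma>" using s(3) by linarith
  obtain j :: nat where j: "2 / h < j" using reals_Archimedean2 by blast
  then have j0: "0 < j" using h by (metis divide_pos_pos gr0I of_nat_0 order_less_asym zero_less_numeral)
  have jh: "1 / j \<le> h / 2" using j h j0 by (simp add: field_simps)
  \<comment> \<open>\<open>c0\<close> times m^\<gamma> bounds \<bar>C(1)\<bar> / \<bar>Q(0)\<bar>
    below: exp(-1) pays for the truncation error in L(1), and 1/2 for the relative error of the
    power.\<close>
  define c0 where "c0 = cmod (poly Q 1) / cmod (poly Q 0) * (s powr \<gamma> * exp (- 1) / 2)"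
  have c0: "0 < c0" using Q(1)[of 1] Q(1)[of 0] s by (simp add: c0_def)
  define d where "d = degree Q"
  have "\<forall>\<^sub>F m in sequentially. D * ((d + 1) + j * real m * (14 / h * (ln (real m))\<^sup>2 + ln (real m) + 3)) powr \<gamma>' \<le> c0 * real m powr \<gamma>"
    using \<gamma> c0 D h j0 by (intro quasilinear_powr_le) auto
  moreover have "\<forall>\<^sub>F m in sequentially. 1 / s < real m"
    using filterlim_real_sequentially filterlim_at_top_dense by blast
  ultimately have "\<forall>\<^sub>F m in sequentially. D * ((d + 1) + j * real m * (14 / h * (ln (real m))\<^sup>2 + ln (real m) + 3)) powr \<gamma>' \<le> c0 * real m powr \<gamma>
      \<and> 1 / s < real m \<and> N < m \<and> 1 < m"
    using eventually_gt_at_top[of N] eventually_gt_at_top[of 1] by eventually_elim auto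
  then obtain m where m: "D * ((d + 1) + j * real m * (14 / h * (ln (real m))\<^sup>2 + ln (real m) + 3)) powr \<gamma>' \<le> c0 * real m powr \<gamma>"
      "1 / s < real m" "N < m" "1 < m"
    by (metis (no_types, lifting) eventually_happens' sequentially_bot)
  have ms: "1 / m < s" using m(2,4) s by (simp add: field_simps)
  note par = s(1,2) m(4) ms j0 refl refl
  define B where "B = ln (real m)"
  have B: "0 < B" using m(4) by (simp add: B_def)
  \<comment> \<open>With \<open>B\<close> = ln m bounding \<bar>L\<bar>, the first summand secures
    relative accuracy h and the others \<open>B < M\<close>. Thus M is of order (ln m)^2.\<close>
  define M where "M = nat \<lceil>14 * B\<^sup>2 / h\<rceil> + nat \<lceil>B\<rceil> + 1"
  have M: "14 * B\<^sup>2 \<le> M * h" "B < M" "0 < M" "real M \<le> 14 / h * B\<^sup>2 + B + 3"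
  proof -
    have "0 \<le> 14 * B\<^sup>2 / h" using h by simp
    then have M_eq: "real M = of_int \<lceil>14 * B\<^sup>2 / h\<rceil> + of_int \<lceil>B\<rceil> + 1"
      using B by (simp add: M_def)
    have "14 * B\<^sup>2 / h \<le> M" unfolding M_eq using B by linarith
    then show "14 * B\<^sup>2 \<le> M * h" using h by (simp add: field_simps)
    show "B < M" unfolding M_eq using \<open>0 \<le> 14 * B\<^sup>2 / h\<close> by linarith
    show "real M \<le> 14 / h * B\<^sup>2 + B + 3" unfolding M_eq times_divide_eq_left by linarith
  qed (simp add: M_def)
  define L where "L = smult (of_real \<gamma>) (log_poly s m j)"
  have L_le: "cmod (poly L z) \<le> B" if "cmod z \<le> 1" for z
  proof -
    have "cmod (poly (log_poly s m j) z) \<le> B"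
      using norm_log_poly_le[OF par that] log_poly_1_bounds(1)[OF par] by (simp add: B_def)
    then have "\<gamma> * cmod (poly (log_poly s m j) z) \<le> 1 * B" using \<gamma> by (intro mult_mono) auto
    then show ?thesis using \<gamma> by (simp add: L_def norm_mult)
  qed
  have L_Im: "\<bar>2 * Im (poly L z)\<bar> \<le> pi * \<gamma> + h" if "cmod z = 1" for z
  proof -
    have "\<bar>Im (poly (log_poly s m j) z)\<bar> \<le> pi / 2 + h / 2"
      using Im_log_poly[OF par that] jh by linarith
    then have "2 * \<gamma> * \<bar>Im (poly (log_poly s m j) z)\<bar> \<le> 2 * \<gamma> * (pi / 2 + h / 2)"
      using \<gamma> by (intro mult_left_mono) auto
    also have "\<dots> = pi * \<gamma> + \<gamma> * h" by (simp add: algebra_simps)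
    also have "\<dots> \<le> pi * \<gamma> + h" using \<gamma> h by simp
    finally show ?thesis using \<gamma> by (simp add: L_def abs_mult)
  qed
  have L_far: "cmod (poly L z) \<le> h" if "cmod z = 1" "\<sigma> \<le> cmod (z - 1)" for z
  proof -
    have "4 * s / \<sigma> \<le> h / 2" using s(3) \<sigma> by (simp add: field_simps)
    then have "cmod (poly (log_poly s m j) z) \<le> h"
      using log_poly_far[OF par that s'] jh by linarith
    then have "\<gamma> * cmod (poly (log_poly s m j) z) \<le> 1 * h" using \<gamma> by (intro mult_mono) auto
    then show ?thesis using \<gamma> by (simp add: L_def norm_mult)
  qed
  define C where "C = Q * (1 + smult (1 / M) L) ^ M"
  define A where "A = Q * (1 + smult (1 / M) (- L)) ^ M"
  have Cz: "poly C z = poly Q z * (1 + poly L z / M) ^ M"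
    and Az: "poly A z = poly Q z * (1 + - poly L z / M) ^ M" for z
    by (simp_all add: C_def A_def)
  have ex: "\<exists>x y. poly C z = poly Q z * exp (poly L z) * (1 + x) \<and> poly A z = poly Q z * exp (- poly L z) * (1 + y) \<and>
      cmod x \<le> h \<and> cmod y \<le> h" if "cmod z \<le> 1" for z
  proof -
    have sq: "14 * (cmod (poly L z))\<^sup>2 \<le> M * h"
      using L_le[OF that] M(1) by (smt (verit, best) norm_ge_zero power_mono)
    have lM: "cmod (poly L z) \<le> M" using L_le[OF that] M(2) by linarith
    obtain x where "(1 + poly L z / M) ^ M = exp (poly L z) * (1 + x)" "cmod x \<le> h"
      using one_plus_power_exp[OF sq lM] h M(3) by auto
    moreover obtain y where "(1 + - poly L z / M) ^ M = exp (- poly L z) * (1 + y)" "cmod y \<le> h"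
      using one_plus_power_exp[of "- poly L z" M h] sq lM h M(3) by auto
    ultimately show ?thesis unfolding Cz Az by (metis mult.assoc)
  qed
  have nz1: "1 + x \<noteq> 0" if "cmod x \<le> h" for x
    using that h by (metis add_eq_0_iff norm_minus_cancel norm_one not_le le_less_trans one_less_numeral_iff divide_less_eq_1_pos semiring_norm(76) zero_less_numeral order_trans)
  \<comment> \<open>One more than the degree bound d + j m M of C and A.\<close>
  define n where "n = d + j * m * M + 1"
  have degL: "degree L \<le> j * m"
    unfolding L_def by (rule order_trans[OF degree_smult_le degree_log_poly])
  have degpow: "degree ((1 + smult c L) ^ M) \<le> j * m * M" for c
  proof -
    have "degree (1 + smult c L) \<le> j * m"
      using degL by (intro degree_add_le) (auto intro: order_trans[OF degree_smult_le])
    then show ?thesis by (intro order_trans[OF degree_power_le]) simp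
  qed
  have L0: "poly L 0 = 0" by (simp add: L_def poly_0_coeff_0 coeff_log_poly_0)
  have C0: "coeff C 0 = poly Q 0" "coeff A 0 = poly Q 0"
    using Cz[of 0] Az[of 0] unfolding L0 by (simp_all add: poly_0_coeff_0)
  have prods: "\<exists>\<zeta> \<xi>. poly C z * cnj (poly A z) = (cmod (poly Q z))\<^sup>2 * (cis (2 * Im (poly L z)) + \<zeta>) \<and> cmod \<zeta> \<le> 3 * h \<and>
      poly C z * poly A z = (poly Q z)\<^sup>2 * (1 + \<xi>) \<and> cmod \<xi> \<le> 3 * h" if z: "cmod z \<le> 1" for z
  proof -
    obtain x y where "poly C z = poly Q z * exp (poly L z) * (1 + x)" "poly A z = poly Q z * exp (- poly L z) * (1 + y)"
      "cmod x \<le> h" "cmod y \<le> h" using ex[OF z] by blast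
    from block_products[OF this] h show ?thesis by fastforce
  qed
  define \<tau>m where "\<tau>m = pi * \<gamma> + h"
  have \<tau>m: "0 \<le> \<tau>m" "\<tau>m < pi / 2" using \<gamma> h h' by (auto simp: \<tau>m_def)
  have trig: "\<bar>sin \<tau>\<bar> \<le> sin \<tau>m" "cos \<tau>m \<le> cos \<tau>" if "\<bar>\<tau>\<bar> \<le> \<tau>m" for \<tau>
  proof -
    have "sin \<bar>\<tau>\<bar> \<le> sin \<tau>m" using that \<tau>m by (intro sin_monotone_2pi_le) auto
    moreover have "\<bar>sin \<tau>\<bar> = sin \<bar>\<tau>\<bar>"
      using that \<tau>m sin_ge_zero[of "\<bar>\<tau>\<bar>"] by (cases "0 \<le> \<tau>") auto
    ultimately show "\<bar>sin \<tau>\<bar> \<le> sin \<tau>m" by simp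
    have "cos \<tau>m \<le> cos \<bar>\<tau>\<bar>" using that \<tau>m by (intro cos_monotone_0_pi_le) auto
    then show "cos \<tau>m \<le> cos \<tau>" by simp
  qed
  interpret op_block C A n
  proof
    have "degree C \<le> d + j * m * M"
      using degree_mult_le[of Q "(1 + smult (1 / M) L) ^ M"] degpow[of "1 / M"] unfolding C_def d_def by linarith
    then show "degree C < n" by (simp add: n_def)
    have "degree A \<le> d + j * m * M"
      using degree_mult_le[of Q "(1 + smult (1 / M) (- L)) ^ M"] degpow[of "- 1 / M"] unfolding A_def d_def by simp
    then show "degree A < n" by (simp add: n_def)
    show "coeff C 0 = coeff A 0" using C0 by simp
    show "poly C z \<noteq> 0" if "cmod z \<le> 1" for z using ex[OF that] Q(1)[OF that] nz1 by auto
    show "poly A z \<noteq> 0" if "cmod z \<le> 1" for z using ex[OF that] Q(1)[OF that] nz1 by auto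
    show "0 < Re (poly C z * cnj (poly A z))" if z: "cmod z = 1" for z
    proof -
      obtain \<zeta> where \<zeta>: "poly C z * cnj (poly A z) = (cmod (poly Q z))\<^sup>2 * (cis (2 * Im (poly L z)) + \<zeta>)" "cmod \<zeta> \<le> 3 * h"
        using prods[of z] z by auto
      have "Re (poly C z * cnj (poly A z)) = (cmod (poly Q z))\<^sup>2 * (cos (2 * Im (poly L z)) + Re \<zeta>)"
        unfolding \<zeta>(1) by simp
      moreover have "0 < cos (2 * Im (poly L z)) + Re \<zeta>"
        using trig(2)[of "2 * Im (poly L z)"] L_Im[OF z] h'(2) \<zeta>(2) abs_Re_le_cmod[of \<zeta>]
        unfolding \<tau>m_def by linarith
      ultimately show ?thesis using Q(1)[of z] z by simp
    qed
  qed
  define P where "P = smult (1 / cnj (coeff C 0)) opoly"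
  have "D * real n powr \<gamma>' \<le> cmod (poly P 1)"
  proof -
    have "real n = (d + 1) + j * real m * real M" by (simp add: n_def)
    also have "\<dots> \<le> (d + 1) + j * real m * (14 / h * (ln (real m))\<^sup>2 + ln (real m) + 3)"
      using M(4) unfolding B_def by (intro add_left_mono mult_left_mono) auto
    finally have "D * real n powr \<gamma>' \<le> D * ((d + 1) + j * real m * (14 / h * (ln (real m))\<^sup>2 + ln (real m) + 3)) powr \<gamma>'"
      using D \<gamma> by (intro mult_left_mono powr_mono2) auto
    also have "\<dots> \<le> c0 * real m powr \<gamma>" by (rule m(1))
    also have "\<dots> \<le> cmod (poly C 1) / cmod (poly Q 0)"
    proof -
      obtain x where x: "poly C 1 = poly Q 1 * exp (poly L 1) * (1 + x)" "cmod x \<le> h"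
        using ex[of 1] by auto
      have "1 / 2 \<le> cmod (1 + x)" using norm_triangle_ineq2[of 1 "- x"] x(2) h by simp
      moreover have "s powr \<gamma> * real m powr \<gamma> * exp (- 1) \<le> exp (Re (poly L 1))"
      proof -
        have "\<gamma> * (ln (s * m) - 1 / j) \<le> Re (poly L 1)"
          using log_poly_1_bounds(2)[OF par] \<gamma> by (simp add: L_def mult_left_mono)
        moreover have "\<gamma> * (1 / j) \<le> 1 * 1" using \<gamma> j0 by (intro mult_mono) auto
        ultimately have "\<gamma> * ln (s * m) - 1 \<le> Re (poly L 1)" by (simp add: right_diff_distrib)
        then have "exp (\<gamma> * ln (s * m) - 1) \<le> exp (Re (poly L 1))" by simp
        moreover have "exp (\<gamma> * ln (s * m) - 1) = s powr \<gamma> * real m powr \<gamma> * exp (- 1)"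
          using s m(4) by (simp add: exp_diff exp_minus powr_def ln_mult distrib_left exp_add field_simps)
        ultimately show ?thesis by simp
      qed
      ultimately have "s powr \<gamma> * real m powr \<gamma> * exp (- 1) * (1 / 2) \<le> exp (Re (poly L 1)) * cmod (1 + x)"
        by (intro mult_mono) auto
      then have "cmod (poly Q 1) / cmod (poly Q 0) * (s powr \<gamma> * real m powr \<gamma> * exp (- 1) * (1 / 2)) \<le>
        cmod (poly Q 1) / cmod (poly Q 0) * (exp (Re (poly L 1)) * cmod (1 + x))"
        by (intro mult_left_mono) auto
      then show ?thesis unfolding x(1) c0_def norm_mult norm_exp_eq_Re by (simp add: mult_ac)
    qed
    also have "\<dots> \<le> cmod (poly P 1)"
    proof -
      \<comment> \<open>L(1) and Q(1) are real, hence so is C(1), and \<bar>C(1)\<bar> equals the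
        modulus of the real part of \<open>opoly\<close> at 1.\<close>
      have L1: "poly L 1 = of_real (\<gamma> * Re (poly (log_poly s m j) 1))"
        using log_poly_1_real[OF par] unfolding L_def poly_smult of_real_mult by (rule arg_cong)
      have "poly C 1 \<in> \<real>"
        using Q(2) unfolding Cz L1 by (intro Reals_mult Reals_power Reals_add Reals_divide) auto
      then have "cmod (poly C 1) = \<bar>Re (poly opoly 1)\<bar>"
        unfolding opoly_at_1 by (metis Reals_cases Re_complex_of_real norm_of_real)
      also have "\<dots> \<le> cmod (poly opoly 1)" by (rule abs_Re_le_cmod)
      finally show ?thesis by (simp add: P_def C0 norm_divide divide_right_mono)
    qed
    finally show ?thesis .
  qed
  moreover have "N < n"
  proof -
    have "m * 1 \<le> m * (j * M)" using j0 M(3) by (intro mult_le_mono) auto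
    then have "N < m * (j * M)" using m(3) by linarith
    then show ?thesis by (simp add: n_def mult_ac)
  qed
  moreover have "(cos (pi * \<gamma> + h) - 3 * h) / (1 + sin (pi * \<gamma> + h) + 6 * h)\<^sup>2 \<le> (cmod (poly Q z))\<^sup>2 * wt z \<and>
      (cmod (poly Q z))\<^sup>2 * wt z \<le> (1 + 3 * h) / (1 - sin (pi * \<gamma> + h) - 6 * h)\<^sup>2" if z: "cmod z = 1" for z
  proof -
    obtain \<zeta> \<xi> where *: "poly C z * cnj (poly A z) = (cmod (poly Q z))\<^sup>2 * (cis (2 * Im (poly L z)) + \<zeta>)" "cmod \<zeta> \<le> 3 * h"
      "poly C z * poly A z = (poly Q z)\<^sup>2 * (1 + \<xi>)" "cmod \<xi> \<le> 3 * h"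
      using prods[of z] z by auto
    show ?thesis
      using wt_bounds[OF z _ *, of "sin \<tau>m" "cos \<tau>m"] Q(1)[of z] z trig[of "2 * Im (poly L z)"] L_Im[OF z] h'
      unfolding \<tau>m_def by auto
  qed
  moreover have "(1 - 5 * h) / (1 + 8 * h)\<^sup>2 \<le> (cmod (poly Q z))\<^sup>2 * wt z \<and>
      (cmod (poly Q z))\<^sup>2 * wt z \<le> (1 + 3 * h) / (1 - 8 * h)\<^sup>2" if z: "cmod z = 1" "\<sigma> \<le> cmod (z - 1)" for z
  proof -
    obtain \<zeta> \<xi> where *: "poly C z * cnj (poly A z) = (cmod (poly Q z))\<^sup>2 * (cis (2 * Im (poly L z)) + \<zeta>)" "cmod \<zeta> \<le> 3 * h"
      "poly C z * poly A z = (poly Q z)\<^sup>2 * (1 + \<xi>)" "cmod \<xi> \<le> 3 * h"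
      using prods[of z] z by auto
    let ?t = "2 * Im (poly L z)"
    \<comment> \<open>A phase of at most 2 h allows S = 2 h and c = 1 - 2 h in
      \<open>wt_bounds\<close>, which yields the constants 5 and 8.\<close>
    have t: "\<bar>?t\<bar> \<le> 2 * h" using L_far[OF z] abs_Im_le_cmod[of "poly L z"] by simp
    have "\<bar>sin ?t\<bar> \<le> 2 * h" using t abs_sin_x_le_abs_x[of ?t] by linarith
    moreover have "1 - 2 * h \<le> cos ?t" using t one_minus_le_cos[of "\<bar>?t\<bar>"] by simp
    ultimately show ?thesis
      using wt_bounds[OF z(1) _ *, of "2 * h" "1 - 2 * h"] Q(1)[of z] z h by (auto simp: add_ac)
  qed
  ultimately show ?thesis
    using continuous_wt monic_op_block unfolding P_def by blast
qed

subsection \<open>Iterating the construction\<close>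

text \<open>The inequalities are strict so that, by compactness, there is always a margin for the
  next modification.\<close>

definition admissible :: "real \<Rightarrow> (complex \<Rightarrow> real) \<Rightarrow> bool" where
  "admissible T W \<longleftrightarrow> continuous_on (sphere 0 1) W \<and> (\<forall>z. cmod z = 1 \<longrightarrow> 1 < W z \<and> W z < T)"

lemma admissible_imp_bounded_weight:
  assumes "admissible T W"
  shows "bounded_weight T (\<lambda>\<theta>. W (cis \<theta>))"
proof -
  have "continuous_on {-pi..pi} (\<lambda>\<theta>. W (cis \<theta>))"
    by (rule continuous_on_compose2[of "sphere 0 1" W])
       (use assms in \<open>auto simp: admissible_def intro!: continuous_intros\<close>)
  then have "(\<lambda>\<theta>. W (cis \<theta>)) \<in> borel_measurable circle_measure"
    by (rule continuous_imp_measurable_on_sets_lebesgue) auto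
  then show ?thesis
    using assms by (simp add: bounded_weight_def admissible_def less_imp_le)
qed

lemma admissible_margin:
  assumes "admissible T W"
  shows "\<exists>\<mu>>0. \<forall>z. cmod z = 1 \<longrightarrow> 1 + \<mu> \<le> W z \<and> W z \<le> T - \<mu>"
proof -
  have "compact (sphere (0::complex) 1)" "sphere (0::complex) 1 \<noteq> {}" "continuous_on (sphere 0 1) W"
    using assms by (auto simp: admissible_def)
  then obtain x y where "cmod x = 1" "\<And>z. cmod z = 1 \<Longrightarrow> W x \<le> W z" "cmod y = 1" "\<And>z. cmod z = 1 \<Longrightarrow> W z \<le> W y"
    using continuous_attains_inf[of "sphere 0 1" W] continuous_attains_sup[of "sphere 0 1" W] by auto
  then show ?thesis
    using assms by (intro exI[of _ "min (W x - 1) (T - W y)"]) (force simp: admissible_def min_def)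
qed

text \<open>A tent function around 1 interpolates between \<open>W\<close> and the constant
  \<kappa>. The value \<kappa> at 1 is chosen so that the block's factors, multiplied by it, stay
  inside (1, T).\<close>

lemma admissible_flatten:
  assumes W: "admissible T W" and \<kappa>: "1 < \<kappa>" "\<kappa> < T" and \<sigma>: "0 < \<sigma>"
  shows "\<exists>V. admissible T V \<and> V 1 = \<kappa> \<and> (\<forall>z. \<sigma> \<le> cmod (z - 1) \<longrightarrow> V z = W z)"
proof -
  define b where "b z = max 0 (1 - cmod (z - 1) / \<sigma>)" for z
  define V where "V z = (1 - b z) * W z + b z * \<kappa>" for z
  have b: "0 \<le> b z" "b z \<le> 1" for z using \<sigma> by (auto simp: b_def)
  have "continuous_on (sphere 0 1) V"
    using W unfolding V_def b_def admissible_def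
    by (intro continuous_intros) (use \<sigma> in auto)
  moreover have "1 < V z \<and> V z < T" if "cmod z = 1" for z
  proof -
    have Wz: "1 < W z" "W z < T" using W that by (auto simp: admissible_def)
    show ?thesis
      unfolding V_def using convex_bound_lt[of "W z" T \<kappa> "1 - b z" "b z"]
        convex_bound_lt[of "- W z" "- 1" "- \<kappa>" "1 - b z" "b z"] b[of z] \<kappa> Wz by auto
  qed
  moreover have "V 1 = \<kappa>" by (simp add: V_def b_def)
  moreover have "V z = W z" if "\<sigma> \<le> cmod (z - 1)" for z
    using that \<sigma> by (simp add: V_def b_def)
  ultimately show ?thesis unfolding admissible_def by blast
qed

text \<open>First flatten W to \<kappa> near 1, then approximate the result by \<bar>Q\<bar>^-2 and
  insert a block at an even smaller scale. Near 1 the hypotheses on \<kappa> keep the weight in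
  range; elsewhere the margin \<mu> does.\<close>

lemma growth_step:
  assumes \<gamma>: "0 < \<gamma>'" "\<gamma>' < \<gamma>" "\<gamma> < 1 / 2"
    and \<kappa>: "1 < cos (pi * \<gamma>) / (1 + sin (pi * \<gamma>))\<^sup>2 * \<kappa>" "1 / (1 - sin (pi * \<gamma>))\<^sup>2 * \<kappa> < T" "1 < \<kappa>" "\<kappa> < T"
    and W: "admissible T W" and \<sigma>: "0 < \<sigma>" and D: "0 < D"
  shows "\<exists>n W' P. N < n \<and> admissible T W' \<and> monic_op (\<lambda>\<theta>. W' (cis \<theta>)) n P \<and>
    D * real n powr \<gamma>' \<le> cmod (poly P 1) \<and>
    (\<forall>z. cmod z = 1 \<longrightarrow> \<sigma> \<le> cmod (z - 1) \<longrightarrow> \<bar>W' z - W z\<bar> \<le> \<sigma>)"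
proof -
  obtain V where V: "admissible T V" "V 1 = \<kappa>" "\<And>z. \<sigma> \<le> cmod (z - 1) \<Longrightarrow> V z = W z"
    using admissible_flatten[OF W \<kappa>(3,4) \<sigma>] by blast
  obtain \<mu> where \<mu>: "0 < \<mu>" "\<And>z. cmod z = 1 \<Longrightarrow> 1 + \<mu> \<le> V z" "\<And>z. cmod z = 1 \<Longrightarrow> V z \<le> T - \<mu>"
    using admissible_margin[OF V(1)] by blast
  have g: "0 < pi * \<gamma>" "pi * \<gamma> < pi / 2" using \<gamma> by auto
  have sc: "0 < sin (pi * \<gamma>)" "sin (pi * \<gamma>) < 1" "0 < cos (pi * \<gamma>)"
  proof -
    show "0 < sin (pi * \<gamma>)" "0 < cos (pi * \<gamma>)" using g by (auto intro!: sin_gt_zero cos_gt_zero)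
    show "sin (pi * \<gamma>) < 1" using sin_monotone_2pi[of "pi * \<gamma>" "pi / 2"] g by simp
  qed
  define lo where "lo h = (cos (pi * \<gamma> + h) - 3 * h) / (1 + sin (pi * \<gamma> + h) + 6 * h)\<^sup>2" for h
  define hi where "hi h = (1 + 3 * h) / (1 - sin (pi * \<gamma> + h) - 6 * h)\<^sup>2" for h
  define flo where "flo h = (1 - 5 * h) / (1 + 8 * h)\<^sup>2" for h :: real
  define fhi where "fhi h = (1 + 3 * h) / (1 - 8 * h)\<^sup>2" for h :: real
  \<comment> \<open>Every condition on h holds strictly in the limit h -> 0, so one small h meets
    them all. Of the two factors beside \<kappa> one is the error of \<bar>Q\<bar>^-2 and the other
    the variation of V near 1.\<close>
  have id: "((\<lambda>h::real. h) \<longlongrightarrow> 0) (at_right 0)" by (rule tendsto_ident_at)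
  have tlo: "(lo \<longlongrightarrow> cos (pi * \<gamma>) / (1 + sin (pi * \<gamma>))\<^sup>2) (at_right 0)"
    unfolding lo_def using sc by (auto intro!: tendsto_eq_intros)
  have thi: "(hi \<longlongrightarrow> 1 / (1 - sin (pi * \<gamma>))\<^sup>2) (at_right 0)"
    unfolding hi_def using sc by (auto intro!: tendsto_eq_intros)
  have tflo: "(flo \<longlongrightarrow> 1) (at_right 0)" unfolding flo_def by (auto intro!: tendsto_eq_intros)
  have tfhi: "(fhi \<longlongrightarrow> 1) (at_right 0)" unfolding fhi_def by (auto intro!: tendsto_eq_intros)
  have "\<forall>\<^sub>F h in at_right 0. 1 < lo h * ((1 - h) * ((1 - h) * \<kappa>))"
    by (rule order_tendstoD(1)[OF _ \<kappa>(1)]) (auto intro!: tendsto_eq_intros tlo)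
  moreover have "\<forall>\<^sub>F h in at_right 0. hi h * ((1 + h) * ((1 + h) * \<kappa>)) < T"
    by (rule order_tendstoD(2)[OF _ \<kappa>(2)]) (auto intro!: tendsto_eq_intros thi)
  moreover have "\<forall>\<^sub>F h in at_right 0. 1 < flo h * ((1 - h) * (1 + \<mu>))"
    by (rule order_tendstoD(1)[of _ "1 + \<mu>"]) (use \<mu> in \<open>auto intro!: tendsto_eq_intros tflo\<close>)
  moreover have "\<forall>\<^sub>F h in at_right 0. fhi h * ((1 + h) * (T - \<mu>)) < T"
    by (rule order_tendstoD(2)[of _ "T - \<mu>"]) (use \<mu> in \<open>auto intro!: tendsto_eq_intros tfhi\<close>)
  moreover have "\<forall>\<^sub>F h in at_right 0. (fhi h * (1 + h) - 1) * T < \<sigma>"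
    by (rule order_tendstoD(2)[of _ 0]) (use \<sigma> in \<open>auto intro!: tendsto_eq_intros tfhi\<close>)
  moreover have "\<forall>\<^sub>F h in at_right 0. (1 - flo h * (1 - h)) * T < \<sigma>"
    by (rule order_tendstoD(2)[of _ 0]) (use \<sigma> in \<open>auto intro!: tendsto_eq_intros tflo\<close>)
  moreover have "\<forall>\<^sub>F h in at_right 0. pi * \<gamma> + h < pi / 2"
    by (rule order_tendstoD(2)[OF _ g(2)]) (auto intro!: tendsto_eq_intros)
  moreover have "\<forall>\<^sub>F h in at_right 0. 0 < cos (pi * \<gamma> + h) - 3 * h"
    by (rule order_tendstoD(1)[OF _ sc(3)]) (auto intro!: tendsto_eq_intros)
  moreover have "\<forall>\<^sub>F h in at_right 0. sin (pi * \<gamma> + h) + 6 * h < 1"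
    by (rule order_tendstoD(2)[OF _ sc(2)]) (auto intro!: tendsto_eq_intros)
  moreover have "\<forall>\<^sub>F h::real in at_right 0. h < 1 / 16"
    by (rule order_tendstoD(2)[OF id]) simp
  moreover have "\<forall>\<^sub>F h::real in at_right 0. 0 < h"
    by (rule eventually_at_right_less)
  ultimately have "\<forall>\<^sub>F h in at_right 0. 1 < lo h * ((1 - h) * ((1 - h) * \<kappa>)) \<and> hi h * ((1 + h) * ((1 + h) * \<kappa>)) < T \<and>
      1 < flo h * ((1 - h) * (1 + \<mu>)) \<and> fhi h * ((1 + h) * (T - \<mu>)) < T \<and> (fhi h * (1 + h) - 1) * T < \<sigma> \<and>
      (1 - flo h * (1 - h)) * T < \<sigma> \<and> pi * \<gamma> + h < pi / 2 \<and> 0 < cos (pi * \<gamma> + h) - 3 * h \<and>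
      sin (pi * \<gamma> + h) + 6 * h < 1 \<and> h < 1 / 16 \<and> 0 < h"
    by eventually_elim blast
  then obtain h where h: "1 < lo h * ((1 - h) * ((1 - h) * \<kappa>))" "hi h * ((1 + h) * ((1 + h) * \<kappa>)) < T"
      "1 < flo h * ((1 - h) * (1 + \<mu>))" "fhi h * ((1 + h) * (T - \<mu>)) < T" "(fhi h * (1 + h) - 1) * T < \<sigma>"
      "(1 - flo h * (1 - h)) * T < \<sigma>" "pi * \<gamma> + h < pi / 2" "0 < cos (pi * \<gamma> + h) - 3 * h"
      "sin (pi * \<gamma> + h) + 6 * h < 1" "h < 1 / 16" "0 < h"
    using eventually_happens'[OF trivial_limit_at_right_real] by blast
  have contV: "continuous_on (sphere 0 1) V" and V1: "\<And>z. cmod z = 1 \<Longrightarrow> 1 < V z \<and> V z < T"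
    using V(1) by (auto simp: admissible_def)
  obtain \<sigma>' where \<sigma>': "0 < \<sigma>'" "\<sigma>' \<le> \<sigma>" "\<And>z. cmod z = 1 \<Longrightarrow> cmod (z - 1) < \<sigma>' \<Longrightarrow> \<bar>V z - \<kappa>\<bar> < h * \<kappa>"
  proof -
    have "0 < h * \<kappa>" using h \<kappa> by simp
    then obtain d where "0 < d" "\<And>z. z \<in> sphere 0 1 \<Longrightarrow> dist z 1 < d \<Longrightarrow> dist (V z) (V 1) < h * \<kappa>"
      using contV[unfolded continuous_on_iff, rule_format, of 1 "h * \<kappa>"] by auto
    then show ?thesis using \<sigma> V(2) by (intro that[of "min d \<sigma>"]) (auto simp: dist_norm)
  qed
  have V0: "0 < V z" if "cmod z = 1" for z using V1[OF that] by simp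
  have h1: "h \<le> 1" using h(10) by simp
  obtain Q :: "complex poly" where Q: "\<And>z. cmod z \<le> 1 \<Longrightarrow> poly Q z \<noteq> 0" "poly Q 1 \<in> \<real>"
    "\<And>z. cmod z = 1 \<Longrightarrow> (1 - h) * V z \<le> 1 / (cmod (poly Q z))\<^sup>2"
    "\<And>z. cmod z = 1 \<Longrightarrow> 1 / (cmod (poly Q z))\<^sup>2 \<le> (1 + h) * V z"
    using inverse_poly_approx[OF contV V0 h(11) h1] by blast
  have h16: "h \<le> 1 / 16" "3 * h < cos (pi * \<gamma> + h)" using h by auto
  obtain n W' P where n: "N < n" and W': "continuous_on (sphere 0 1) W'"
    and P: "weight (\<lambda>\<theta>. W' (cis \<theta>)) \<Longrightarrow> monic_op (\<lambda>\<theta>. W' (cis \<theta>)) n P" "D * real n powr \<gamma>' \<le> cmod (poly P 1)"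
    and near: "\<And>z. cmod z = 1 \<Longrightarrow> lo h \<le> (cmod (poly Q z))\<^sup>2 * W' z \<and> (cmod (poly Q z))\<^sup>2 * W' z \<le> hi h"
    and far: "\<And>z. cmod z = 1 \<Longrightarrow> \<sigma>' \<le> cmod (z - 1) \<Longrightarrow> flo h \<le> (cmod (poly Q z))\<^sup>2 * W' z \<and> (cmod (poly Q z))\<^sup>2 * W' z \<le> fhi h"
    using growth_block[OF \<gamma> h(11) h16(1) h(7) h16(2) h(9) \<sigma>'(1) Q(1,2) D, of N]
    unfolding lo_def hi_def flo_def fhi_def by blast
  have pos: "0 < lo h" "0 < hi h" "0 < flo h" "0 < fhi h"
  proof -
    have "0 \<le> sin (pi * \<gamma> + h)" using h g by (intro sin_ge_zero) auto
    then show "0 < lo h" unfolding lo_def using h by (intro divide_pos_pos zero_less_power) auto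
    show "0 < hi h" unfolding hi_def using h by (intro divide_pos_pos zero_less_power) auto
    show "0 < flo h" "0 < fhi h" unfolding flo_def fhi_def using h by (auto intro!: divide_pos_pos zero_less_power)
  qed
  \<comment> \<open>Bounds on \<bar>Q\<bar>^2 W' become bounds on W' after multiplication by those
    on \<bar>Q\<bar>^-2.\<close>
  have prod: "a * ((1 - h) * V z) \<le> W' z \<and> W' z \<le> b * ((1 + h) * V z)"
    if z: "cmod z = 1" and "0 < a" "0 < b" and ab: "a \<le> (cmod (poly Q z))\<^sup>2 * W' z" "(cmod (poly Q z))\<^sup>2 * W' z \<le> b" for z a b
  proof -
    let ?v = "(cmod (poly Q z))\<^sup>2 * W' z" and ?q = "1 / (cmod (poly Q z))\<^sup>2"
    have eq: "W' z = ?v * ?q" using Q(1)[of z] z by simp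
    have "0 \<le> (1 - h) * V z" using V1[OF z] h by (intro mult_nonneg_nonneg) auto
    then have "a * ((1 - h) * V z) \<le> ?v * ?q" "?v * ?q \<le> b * ((1 + h) * V z)"
      using Q(3,4)[OF z] ab that(2,3) by (intro mult_mono; simp)+
    then show ?thesis using eq by simp
  qed
  have range: "1 < W' z \<and> W' z < T" if z: "cmod z = 1" for z
  proof (cases "\<sigma>' \<le> cmod (z - 1)")
    case True
    note b = prod[OF z pos(3,4) far[OF z True, THEN conjunct1] far[OF z True, THEN conjunct2]]
    have "flo h * ((1 - h) * (1 + \<mu>)) \<le> flo h * ((1 - h) * V z)"
      using \<mu>(2)[OF z] h pos by (intro mult_left_mono) auto
    moreover have "fhi h * ((1 + h) * V z) \<le> fhi h * ((1 + h) * (T - \<mu>))"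
      using \<mu>(3)[OF z] h pos by (intro mult_left_mono) auto
    ultimately show ?thesis using b h by linarith
  next
    case False
    note b = prod[OF z pos(1,2) near[OF z, THEN conjunct1] near[OF z, THEN conjunct2]]
    have Vz: "(1 - h) * \<kappa> \<le> V z" "V z \<le> (1 + h) * \<kappa>"
      using \<sigma>'(3)[OF z] False by (auto simp: algebra_simps)
    have "lo h * ((1 - h) * ((1 - h) * \<kappa>)) \<le> lo h * ((1 - h) * V z)"
      using Vz h pos by (intro mult_left_mono) auto
    moreover have "hi h * ((1 + h) * V z) \<le> hi h * ((1 + h) * ((1 + h) * \<kappa>))"
      using Vz h pos by (intro mult_left_mono) auto
    ultimately show ?thesis using b h by linarith
  qed
  then have adm: "admissible T W'" using W' by (simp add: admissible_def)
  moreover have "\<bar>W' z - W z\<bar> \<le> \<sigma>" if z: "cmod z = 1" and s: "\<sigma> \<le> cmod (z - 1)" for z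
  proof -
    have s': "\<sigma>' \<le> cmod (z - 1)" using s \<sigma>'(2) by linarith
    note b = prod[OF z pos(3,4) far[OF z s', THEN conjunct1] far[OF z s', THEN conjunct2]]
    \<comment> \<open>\<open>flo h * (1 - h)\<close> is at most 1 and \<open>fhi h * (1 + h)\<close>
      at least 1, so replacing V by its upper bound T only enlarges the error; V = W at these
      points.\<close>
    have "flo h \<le> 1 / 1" unfolding flo_def using h by (intro frac_le) auto
    then have "flo h * (1 - h) \<le> 1 * 1" using h pos by (intro mult_mono) auto
    then have "(1 - flo h * (1 - h)) * V z \<le> (1 - flo h * (1 - h)) * T"
      using V1[OF z] by (intro mult_left_mono) auto
    moreover have "1 / 1 \<le> fhi h"
      unfolding fhi_def using h by (intro frac_le power_le_one) auto
    then have "1 * 1 \<le> fhi h * (1 + h)" using h by (intro mult_mono) auto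
    then have "(fhi h * (1 + h) - 1) * V z \<le> (fhi h * (1 + h) - 1) * T"
      using V1[OF z] by (intro mult_left_mono) auto
    ultimately have "V z - \<sigma> \<le> W' z" "W' z \<le> V z + \<sigma>"
      using b h(5,6) by (simp_all add: algebra_simps)
    then show ?thesis using V(3)[OF s] by auto
  qed
  ultimately show ?thesis
    using n P bounded_weight_imp_weight[OF admissible_imp_bounded_weight[OF adm]] by blast
qed

text \<open>Growth that survives all later modifications: these may be arbitrary near 1 and add up
  to at most 2 \<sigma> elsewhere. The factor sqrt(2 pi T) prepays the passage to orthonormal
  polynomials.\<close>

definition robust_growth :: "real \<Rightarrow> real \<Rightarrow> (complex \<Rightarrow> real) \<Rightarrow> nat \<Rightarrow> real \<Rightarrow> bool" where
  "robust_growth T \<gamma> W n \<sigma> \<longleftrightarrow> (\<forall>w P. bounded_weight T w \<longrightarrow> monic_op w n P \<longrightarrow>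
     (\<forall>\<theta>\<in>{-pi..pi}. \<sigma> \<le> cmod (cis \<theta> - 1) \<longrightarrow> \<bar>w \<theta> - W (cis \<theta>)\<bar> \<le> 2 * \<sigma>) \<longrightarrow>
     sqrt (2 * pi * T) * real n powr \<gamma> \<le> cmod (poly P 1))"

text \<open>The block is built with twice the required growth, and stability loses at most half.
  Halving \<sigma> at each step makes the total deviation a geometric series.\<close>

lemma robust_growth_step:
  assumes \<gamma>: "0 < \<gamma>'" "\<gamma>' < \<gamma>" "\<gamma> < 1 / 2"
    and \<kappa>: "1 < cos (pi * \<gamma>) / (1 + sin (pi * \<gamma>))\<^sup>2 * \<kappa>" "1 / (1 - sin (pi * \<gamma>))\<^sup>2 * \<kappa> < T" "1 < \<kappa>" "\<kappa> < T"
    and W: "admissible T W" and \<sigma>: "0 < \<sigma>"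
  shows "\<exists>W' n \<sigma>'. N < n \<and> admissible T W' \<and> 0 < \<sigma>' \<and> \<sigma>' \<le> \<sigma> / 2 \<and> robust_growth T \<gamma>' W' n \<sigma>' \<and>
    (\<forall>z. cmod z = 1 \<longrightarrow> \<sigma> \<le> cmod (z - 1) \<longrightarrow> \<bar>W' z - W z\<bar> \<le> \<sigma>)"
proof -
  define K where "K = sqrt (2 * pi * T)"
  have K: "0 < K" using \<kappa>(3,4) by (simp add: K_def)
  obtain n W' P where n: "N < n" "admissible T W'" "monic_op (\<lambda>\<theta>. W' (cis \<theta>)) n P"
    "2 * K * real n powr \<gamma>' \<le> cmod (poly P 1)"
    "\<forall>z. cmod z = 1 \<longrightarrow> \<sigma> \<le> cmod (z - 1) \<longrightarrow> \<bar>W' z - W z\<bar> \<le> \<sigma>"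
    using growth_step[OF \<gamma> \<kappa> W \<sigma>, of "2 * K" N] K by auto
  have "0 < K * real n powr \<gamma>'" using K n(1) by simp
  from monic_op_stable[OF admissible_imp_bounded_weight[OF n(2)] n(3) this]
  obtain \<sigma>0 where \<sigma>0: "0 < \<sigma>0" "\<And>w' P'. bounded_weight T w' \<Longrightarrow> monic_op w' n P' \<Longrightarrow>
     (\<forall>\<theta>\<in>{-pi..pi}. \<sigma>0 \<le> cmod (cis \<theta> - 1) \<longrightarrow> \<bar>w' \<theta> - W' (cis \<theta>)\<bar> \<le> 2 * \<sigma>0) \<Longrightarrow>
     cmod (poly P' 1 - poly P 1) \<le> K * real n powr \<gamma>'"
    by blast
  define \<sigma>' where "\<sigma>' = min \<sigma>0 (\<sigma> / 2)"
  have "robust_growth T \<gamma>' W' n \<sigma>'"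
    unfolding robust_growth_def
  proof (intro allI impI)
    fix w P'
    assume w: "bounded_weight T w" "monic_op w n P'"
      and close: "\<forall>\<theta>\<in>{-pi..pi}. \<sigma>' \<le> cmod (cis \<theta> - 1) \<longrightarrow> \<bar>w \<theta> - W' (cis \<theta>)\<bar> \<le> 2 * \<sigma>'"
    have "\<forall>\<theta>\<in>{-pi..pi}. \<sigma>0 \<le> cmod (cis \<theta> - 1) \<longrightarrow> \<bar>w \<theta> - W' (cis \<theta>)\<bar> \<le> 2 * \<sigma>0"
      using close unfolding \<sigma>'_def by fastforce
    from \<sigma>0(2)[OF w this] have "cmod (poly P' 1 - poly P 1) \<le> K * real n powr \<gamma>'" .
    moreover have "cmod (poly P 1) \<le> cmod (poly P' 1) + cmod (poly P' 1 - poly P 1)"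
      using norm_triangle_ineq2[of "poly P 1" "poly P' 1"] by (simp add: norm_minus_commute)
    ultimately show "sqrt (2 * pi * T) * real n powr \<gamma>' \<le> cmod (poly P' 1)"
      using n(4) by (simp add: K_def)
  qed
  moreover have "0 < \<sigma>'" "\<sigma>' \<le> \<sigma> / 2" using \<sigma> \<sigma>0(1) by (auto simp: \<sigma>'_def)
  ultimately show ?thesis using n by blast
qed

text \<open>Dependent choice iterates the step over triples of weight, degree and scale. The limit
  weight stays in each robustness neighbourhood, so all the chosen degrees show growth at
  once.\<close>

lemma bounded_weight_growth_aux:
  assumes \<gamma>: "0 < \<gamma>'" "\<gamma>' < \<gamma>" "\<gamma> < 1 / 2"
    and \<kappa>: "1 < cos (pi * \<gamma>) / (1 + sin (pi * \<gamma>))\<^sup>2 * \<kappa>" "1 / (1 - sin (pi * \<gamma>))\<^sup>2 * \<kappa> < T" "1 < \<kappa>" "\<kappa> < T"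
  shows "\<exists>w (k :: nat \<Rightarrow> nat). bounded_weight T w \<and> strict_mono k \<and> (\<forall>i. 1 \<le> k i) \<and>
     (\<forall>i P. monic_op w (k i) P \<longrightarrow> sqrt (2 * pi * T) * real (k i) powr \<gamma>' \<le> cmod (poly P 1))"
proof -
  define good where "good x = (case x of (W, n, \<sigma>) \<Rightarrow> admissible T W \<and> 0 < \<sigma> \<and> 0 < n \<and> robust_growth T \<gamma>' W n \<sigma>)"
    for x :: "(complex \<Rightarrow> real) \<times> nat \<times> real"
  define rel where "rel x y = (case (x, y) of ((W, n, \<sigma>), (W', n', \<sigma>')) \<Rightarrow> n < n' \<and> \<sigma>' \<le> \<sigma> / 2 \<and>
    (\<forall>z. cmod z = 1 \<longrightarrow> \<sigma> \<le> cmod (z - 1) \<longrightarrow> \<bar>W' z - W z\<bar> \<le> \<sigma>))"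
    for x y :: "(complex \<Rightarrow> real) \<times> nat \<times> real"
  have "\<exists>f. \<forall>i :: nat. good (f i) \<and> rel (f i) (f (Suc i))"
  proof (rule dependent_nat_choice)
    \<comment> \<open>The iteration starts from one step applied to the constant weight \<kappa>,
      with scale 1 and degree bound 0, so that all degrees are positive.\<close>
    have "admissible T (\<lambda>_. \<kappa>)" using \<kappa> by (simp add: admissible_def)
    from robust_growth_step[OF \<gamma> \<kappa> this zero_less_one, of 0] show "\<exists>x. good x"
      unfolding good_def by auto
    fix x and i :: nat assume "good x"
    then obtain W n \<sigma> where x: "x = (W, n, \<sigma>)" "admissible T W" "0 < \<sigma>" "0 < n"
      unfolding good_def by (cases x) auto
    from robust_growth_step[OF \<gamma> \<kappa> x(2,3), of n]
    obtain W' n' \<sigma>' where "n < n'" "admissible T W'" "0 < \<sigma>'" "\<sigma>' \<le> \<sigma> / 2" "robust_growth T \<gamma>' W' n' \<sigma>'"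
      "\<forall>z. cmod z = 1 \<longrightarrow> \<sigma> \<le> cmod (z - 1) \<longrightarrow> \<bar>W' z - W z\<bar> \<le> \<sigma>" by blast
    then show "\<exists>y. good y \<and> rel x y"
      using x by (intro exI[of _ "(W', n', \<sigma>')"]) (auto simp: good_def rel_def)
  qed
  then obtain f where f: "\<And>i. good (f i)" "\<And>i. rel (f i) (f (Suc i))" by blast
  define W where "W i = fst (f i)" for i
  define k where "k i = fst (snd (f i))" for i
  define \<sigma> where "\<sigma> i = snd (snd (f i))" for i
  have feq: "f i = (W i, k i, \<sigma> i)" for i by (simp add: W_def k_def \<sigma>_def)
  have adm: "admissible T (W i)" and \<sigma>0: "0 < \<sigma> i" and k0: "0 < k i" and rob: "robust_growth T \<gamma>' (W i) (k i) (\<sigma> i)" for i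
    using f(1)[of i] unfolding feq good_def by auto
  have k: "k i < k (Suc i)" and \<sigma>: "\<sigma> (Suc i) \<le> \<sigma> i / 2"
    and step: "\<And>z. cmod z = 1 \<Longrightarrow> \<sigma> i \<le> cmod (z - 1) \<Longrightarrow> \<bar>W (Suc i) z - W i z\<bar> \<le> \<sigma> i" for i
    using f(2)[of i] unfolding feq rel_def by auto
  have \<sigma>mono: "\<sigma> (i + l) \<le> \<sigma> i" for i l
  proof (induction l)
    case (Suc l)
    then show ?case using \<sigma>[of "i + l"] \<sigma>0[of "i + l"] by simp
  qed simp
  \<comment> \<open>The form 2 \<sigma>_i - 2 \<sigma>_{i+l} makes the telescoping induction close:
    halving means \<sigma>_k is at most 2 \<sigma>_k - 2 \<sigma>_{k+1}.\<close>
  have close: "\<bar>W (i + l) z - W i z\<bar> \<le> 2 * \<sigma> i - 2 * \<sigma> (i + l)" if "cmod z = 1" "\<sigma> i \<le> cmod (z - 1)" for i l z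
  proof (induction l)
    case (Suc l)
    have "\<bar>W (Suc (i + l)) z - W (i + l) z\<bar> \<le> \<sigma> (i + l)"
      using step[OF that(1), of "i + l"] that(2) \<sigma>mono[of i l] by simp
    then show ?case using Suc \<sigma>[of "i + l"] by simp
  qed simp
  have \<sigma>pow: "\<sigma> i \<le> \<sigma> 0 * (1 / 2) ^ i" for i
  proof (induction i)
    case (Suc i)
    then show ?case using \<sigma>[of i] by simp
  qed simp
  have \<sigma>tend: "(\<lambda>i. \<sigma> 0 * (1 / 2) ^ i) \<longlonglongrightarrow> \<sigma> 0 * 0"
    by (intro tendsto_intros LIMSEQ_power_zero) simp
  have \<sigma>lim: "\<forall>\<^sub>F i in sequentially. \<sigma> i < e" if "0 < e" for e
  proof -
    have "\<forall>\<^sub>F i in sequentially. \<sigma> 0 * (1 / 2) ^ i < e"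
      using order_tendstoD(2)[OF \<sigma>tend] that by simp
    then show ?thesis
      by (rule eventually_mono) (use \<sigma>pow le_less_trans in blast)
  qed
  have conv: "convergent (\<lambda>i. W i z)" if z: "cmod z = 1" "z \<noteq> 1" for z
  proof (rule Cauchy_convergent, rule metric_CauchyI)
    fix e :: real assume "0 < e"
    then have "\<forall>\<^sub>F i in sequentially. \<sigma> i < min (e / 4) (cmod (z - 1))"
      using z by (intro \<sigma>lim) auto
    then obtain i where i: "\<sigma> i < e / 4" "\<sigma> i \<le> cmod (z - 1)"
      unfolding eventually_sequentially by fastforce
    have "\<bar>W m z - W i z\<bar> < e / 2" if "m \<ge> i" for m
      using close[OF z(1) i(2), of "m - i"] that i(1) \<sigma>0[of m] by simp
    then show "\<exists>M. \<forall>m\<ge>M. \<forall>n\<ge>M. dist (W m z) (W n z) < e"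
      unfolding dist_real_def by (intro exI[of _ i]) (smt (verit, best) field_sum_of_halves)
  qed
  \<comment> \<open>The modifications concentrate at z = 1, where convergence is not guaranteed. The
    value 1 put there keeps the pointwise bounds.\<close>
  define w where "w \<theta> = (if \<theta> = 0 then 1 else lim (\<lambda>i. W i (cis \<theta>)))" for \<theta> :: real
  have cis1: "0 < cmod (cis \<theta> - 1)" if "\<theta> \<in> {-pi..pi}" "\<theta> \<noteq> 0" for \<theta>
    using that by (intro less_le_trans[OF _ cis_minus_one_ge[OF that(1)]]) auto
  have lim: "(\<lambda>i. W i (cis \<theta>)) \<longlonglongrightarrow> w \<theta>" if "\<theta> \<in> {-pi..pi}" "\<theta> \<noteq> 0" for \<theta>
    using conv[of "cis \<theta>"] cis1[OF that] that by (simp add: w_def convergent_LIMSEQ_iff)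
  have "w \<in> borel_measurable circle_measure"
  proof (rule borel_measurable_LIMSEQ_real)
    fix \<theta> assume "\<theta> \<in> space circle_measure"
    then show "(\<lambda>i. if \<theta> = 0 then 1 else W i (cis \<theta>)) \<longlonglongrightarrow> w \<theta>"
      using lim[of \<theta>] by (auto simp: w_def)
  next
    fix i
    have "(\<lambda>\<theta>::real. \<theta>) \<in> borel_measurable circle_measure"
      by (intro continuous_imp_measurable_on_sets_lebesgue continuous_intros) auto
    moreover have "(\<lambda>\<theta>. W i (cis \<theta>)) \<in> borel_measurable circle_measure"
      using admissible_imp_bounded_weight[OF adm] by (simp add: bounded_weight_def)
    ultimately show "(\<lambda>\<theta>. if \<theta> = 0 then 1 else W i (cis \<theta>)) \<in> borel_measurable circle_measure"
      by measurable
  qed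
  moreover have "1 \<le> w \<theta> \<and> w \<theta> \<le> T" if "\<theta> \<in> {-pi..pi}" for \<theta>
  proof (cases "\<theta> = 0")
    case True
    then show ?thesis using \<kappa> by (simp add: w_def)
  next
    case False
    have "1 \<le> W i (cis \<theta>)" "W i (cis \<theta>) \<le> T" for i
      using adm[of i] by (auto simp: admissible_def less_imp_le)
    then show ?thesis
      using LIMSEQ_le_const[OF lim[OF that False]] LIMSEQ_le_const2[OF lim[OF that False]] by blast
  qed
  ultimately have bw: "bounded_weight T w" by (simp add: bounded_weight_def)
  have w_close: "\<bar>w \<theta> - W i (cis \<theta>)\<bar> \<le> 2 * \<sigma> i" if \<theta>: "\<theta> \<in> {-pi..pi}" "\<sigma> i \<le> cmod (cis \<theta> - 1)" for \<theta> i
  proof -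
    have "\<theta> \<noteq> 0" using \<theta> \<sigma>0[of i] by auto
    then have "(\<lambda>l. \<bar>W l (cis \<theta>) - W i (cis \<theta>)\<bar>) \<longlonglongrightarrow> \<bar>w \<theta> - W i (cis \<theta>)\<bar>"
      using lim[OF \<theta>(1)] by (intro tendsto_intros) auto
    moreover have "\<bar>W l (cis \<theta>) - W i (cis \<theta>)\<bar> \<le> 2 * \<sigma> i" if "l \<ge> i" for l
      using close[of "cis \<theta>" i "l - i"] that \<theta> \<sigma>0[of l] by simp
    ultimately show ?thesis by (intro LIMSEQ_le_const2) auto
  qed
  have "sqrt (2 * pi * T) * real (k i) powr \<gamma>' \<le> cmod (poly P 1)" if "monic_op w (k i) P" for i P
    using rob[of i] bw that w_close unfolding robust_growth_def by blast
  moreover have "strict_mono k" using k by (simp add: strict_mono_Suc_iff)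
  moreover have "1 \<le> k i" for i using k0[of i] by simp
  ultimately show ?thesis using bw by blast
qed

text \<open>The hypothesis on T says exactly that an interval of suitable values \<kappa> is
  nonempty. The factor sqrt(2 pi T) then cancels on passing to orthonormal polynomials.\<close>

lemma bounded_weight_growth:
  assumes \<gamma>: "0 < \<gamma>'" "\<gamma>' < \<gamma>" "\<gamma> < 1 / 2"
    and T: "(1 + sin (pi * \<gamma>))\<^sup>2 < T * (cos (pi * \<gamma>) * (1 - sin (pi * \<gamma>))\<^sup>2)"
  shows "\<exists>w \<phi> (k :: nat \<Rightarrow> nat). bounded_weight T w \<and> orthonormal_polynomials w \<phi> \<and> strict_mono k \<and> (\<forall>i. 1 \<le> k i) \<and>
     (\<forall>i. real (k i) powr \<gamma>' \<le> cmod (poly (\<phi> (k i)) 1))"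
proof -
  define S c where "S = sin (pi * \<gamma>)" and "c = cos (pi * \<gamma>)"
  have g: "0 < pi * \<gamma>" "pi * \<gamma> < pi / 2" using \<gamma> by auto
  have S: "0 < S" "S < 1" and c: "0 < c" "c \<le> 1"
    using g sin_monotone_2pi[of "pi * \<gamma>" "pi / 2"] unfolding S_def c_def
    by (auto intro!: sin_gt_zero cos_gt_zero)
  have T': "(1 + S)\<^sup>2 / c < T * (1 - S)\<^sup>2"
    using T c unfolding S_def[symmetric] c_def[symmetric] by (simp add: divide_less_eq mult_ac)
  obtain \<kappa> where \<kappa>: "(1 + S)\<^sup>2 / c < \<kappa>" "\<kappa> < T * (1 - S)\<^sup>2" using dense[OF T'] by blast
  have "1 * 1 < (1 + S)\<^sup>2" using S by simp
  then have "1 < (1 + S)\<^sup>2 / c" using c by (simp add: less_divide_eq)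
  then have \<kappa>1: "1 < \<kappa>" using \<kappa> by linarith
  have S1: "0 < (1 - S)\<^sup>2" "(1 - S)\<^sup>2 \<le> 1" using S by (auto simp: power_le_one)
  have "0 < T * (1 - S)\<^sup>2" using \<kappa> \<kappa>1 by linarith
  then have T0: "0 < T" using S1 by (simp add: zero_less_mult_iff)
  have "T * (1 - S)\<^sup>2 \<le> T * 1" using T0 S1 by (intro mult_left_mono) auto
  then have \<kappa>T: "\<kappa> < T" using \<kappa> by linarith
  have a: "1 < c / (1 + S)\<^sup>2 * \<kappa>" using \<kappa>(1) c S by (simp add: field_simps)
  have b: "1 / (1 - S)\<^sup>2 * \<kappa> < T" using \<kappa>(2) S1 by (simp add: divide_less_eq)
  obtain w and k :: "nat \<Rightarrow> nat" where w: "bounded_weight T w" "strict_mono k" "\<And>i. 1 \<le> k i"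
    "\<And>i P. monic_op w (k i) P \<Longrightarrow> sqrt (2 * pi * T) * real (k i) powr \<gamma>' \<le> cmod (poly P 1)"
    using bounded_weight_growth_aux[OF \<gamma> a[unfolded S_def c_def] b[unfolded S_def] \<kappa>1 \<kappa>T] by blast
  obtain \<phi> where \<phi>: "orthonormal_polynomials w \<phi>"
    "\<And>n P z. monic_op w n P \<Longrightarrow> cmod (poly P z) \<le> sqrt (2 * pi * T) * cmod (poly (\<phi> n) z)"
    using orthonormal_polynomials_exist[OF w(1)] by blast
  have growth: "real (k i) powr \<gamma>' \<le> cmod (poly (\<phi> (k i)) 1)" for i
  proof -
    obtain P where P: "monic_op w (k i) P" using monic_op_exists[OF w(1)] by blast
    have "sqrt (2 * pi * T) * real (k i) powr \<gamma>' \<le> sqrt (2 * pi * T) * cmod (poly (\<phi> (k i)) 1)"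
      using w(4)[OF P] \<phi>(2)[OF P, of 1] by linarith
    then show ?thesis by (rule mult_left_le_imp_le) (use T0 in simp)
  qed
  show ?thesis using w(1-3) \<phi>(1) growth by blast
qed

section \<open>From the value at 1 to the essential supremum, and the choice of \<gamma>\<close>

lemma Linf_norm_circle_ge: "ereal (cmod (poly p 1)) \<le> Linf_norm_circle (poly p)"
proof (rule ccontr)
  define f where "f \<theta> = cmod (poly p (cis \<theta>))" for \<theta>
  assume "\<not> ?thesis"
  then have "esssup circle_measure (\<lambda>\<theta>. ereal (f \<theta>)) < ereal (f 0)"
    by (simp add: Linf_norm_circle_def f_def)
  then obtain c where c: "esssup circle_measure (\<lambda>\<theta>. ereal (f \<theta>)) < ereal c" "c < f 0"
    using ereal_dense2 less_ereal.simps(1) by metis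
  have contf: "continuous_on A f" for A unfolding f_def by (intro continuous_intros)
  have "f \<in> borel_measurable circle_measure"
    by (rule continuous_imp_measurable_on_sets_lebesgue[OF contf]) auto
  then have "AE \<theta> in circle_measure. ereal (f \<theta>) \<le> esssup circle_measure (\<lambda>\<theta>. ereal (f \<theta>))"
    by (intro esssup_AE)
  moreover have "f \<theta> \<le> c" if "ereal (f \<theta>) \<le> esssup circle_measure (\<lambda>\<theta>. ereal (f \<theta>))" for \<theta>
    using le_less_trans[OF that c(1)] by simp
  ultimately have "AE \<theta> in circle_measure. f \<theta> \<le> c"
    by (rule eventually_mono)
  then have "AE \<theta> in lebesgue. \<theta> \<in> {-pi..pi} \<longrightarrow> f \<theta> \<le> c"
    by (subst (asm) AE_restrict_space_iff) auto
  then obtain N where "N \<in> null_sets lebesgue" "{\<theta> \<in> space lebesgue. \<not> (\<theta> \<in> {-pi..pi} \<longrightarrow> f \<theta> \<le> c)} \<subseteq> N"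
    unfolding eventually_ae_filter by blast
  then have "negligible {\<theta> \<in> space lebesgue. \<not> (\<theta> \<in> {-pi..pi} \<longrightarrow> f \<theta> \<le> c)}"
    unfolding negligible_iff_null_sets[symmetric] by (rule negligible_subset)
  moreover have "{-pi<..<pi} \<inter> f -` {c<..} \<subseteq> {\<theta> \<in> space lebesgue. \<not> (\<theta> \<in> {-pi..pi} \<longrightarrow> f \<theta> \<le> c)}" by auto
  ultimately have "negligible ({-pi<..<pi} \<inter> f -` {c<..})" by (rule negligible_subset)
  \<comment> \<open>By continuity, a value at 1 above the essential supremum would give a nonempty
    open null set. The open interval is used so that the set is open in the line.\<close>
  moreover have "open ({-pi<..<pi} \<inter> f -` {c<..})"
    by (intro continuous_open_preimage contf) auto
  moreover have "0 \<in> {-pi<..<pi} \<inter> f -` {c<..}" using c by simp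
  ultimately show False using open_not_negligible by blast
qed

text \<open>With x = pi \<gamma>, the left side is at most 1 + 3 x and the right side at least (1 +
  \<epsilon>)(1 - 3 x). The choice \<epsilon>/40 and pi < 4 give x < \<epsilon>/10, which
  suffices.\<close>

lemma growth_parameters_small:
  assumes "0 < \<epsilon>" "\<epsilon> \<le> 1" "\<gamma> = \<epsilon> / 40"
  shows "(1 + sin (pi * \<gamma>))\<^sup>2 < (1 + \<epsilon>) * (cos (pi * \<gamma>) * (1 - sin (pi * \<gamma>))\<^sup>2)"
proof -
  define x where "x = pi * \<gamma>"
  have x: "0 < x" "x < \<epsilon> / 10" using assms pi_less_4 by (auto simp: x_def)
  have S: "0 \<le> sin x" "sin x \<le> x" using x assms pi_gt3 by (auto intro!: sin_ge_zero sin_x_le_x)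
  have c: "1 - x \<le> cos x" using x by (intro one_minus_le_cos) auto
  have "(1 + sin x)\<^sup>2 \<le> (1 + x)\<^sup>2" using S by (intro power_mono) auto
  also have "\<dots> = 1 + 2 * x + x * x" by (simp add: power2_eq_square algebra_simps)
  also have "\<dots> \<le> 1 + 3 * x" using x assms by (simp add: mult_le_cancel_right1)
  also have "\<dots> < (1 + \<epsilon>) * (1 - 3 * x)"
  proof -
    have "x * \<epsilon> \<le> x * 1" using x assms by (intro mult_left_mono) auto
    then have "0 < \<epsilon> - 6 * x - 3 * (x * \<epsilon>)" using x assms by linarith
    then show ?thesis by (simp add: algebra_simps)
  qed
  also have "\<dots> \<le> (1 + \<epsilon>) * ((1 - x) * (1 - x)\<^sup>2)"
  proof (rule mult_left_mono)
    have "(1 - x) * (1 - x)\<^sup>2 - (1 - 3 * x) = x * x * (3 - x)"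
      by (simp add: power2_eq_square algebra_simps)
    moreover have "0 \<le> x * x * (3 - x)" using x assms by (intro mult_nonneg_nonneg) auto
    ultimately show "1 - 3 * x \<le> (1 - x) * (1 - x)\<^sup>2" by linarith
  qed (use assms in simp)
  also have "\<dots> \<le> (1 + \<epsilon>) * (cos x * (1 - sin x)\<^sup>2)"
    using x assms c S by (intro mult_left_mono mult_mono power_mono) auto
  finally show ?thesis by (simp add: x_def)
qed

text \<open>Near \<gamma> = 1/2 the cosine is at least 2 \<delta> and 1 - sine at least 2
  \<delta>^2, so the right side is at least 8 T \<delta>^5 = 8 T^(1/6), while the left side is at
  most 4.\<close>

lemma growth_parameters_large:
  assumes T: "2 \<le> T" and \<delta>: "\<delta> = T powr (- 1 / 6)" "\<delta> < 1 / 4"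
  shows "(1 + sin (pi * (1 / 2 - \<delta>)))\<^sup>2 < T * (cos (pi * (1 / 2 - \<delta>)) * (1 - sin (pi * (1 / 2 - \<delta>)))\<^sup>2)"
proof -
  have \<delta>0: "0 < \<delta>" using T by (simp add: \<delta>)
  have eq: "pi * (1 / 2 - \<delta>) = pi / 2 - pi * \<delta>" by (simp add: algebra_simps)
  have S: "sin (pi * (1 / 2 - \<delta>)) = cos (pi * \<delta>)" and C: "cos (pi * (1 / 2 - \<delta>)) = sin (pi * \<delta>)"
    unfolding eq by (simp_all add: sin_diff cos_diff)
  have s1: "2 * \<delta> \<le> sin (pi * \<delta>)" using sin_ge_linear[of "pi * \<delta>"] \<delta> \<delta>0 by simp
  have s2: "\<delta> \<le> sin (pi * \<delta> / 2)" using sin_ge_linear[of "pi * \<delta> / 2"] \<delta> \<delta>0 by simp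
  have "1 - cos (2 * (pi * \<delta> / 2)) = 2 * (sin (pi * \<delta> / 2))\<^sup>2" by (subst cos_double_sin) simp
  moreover have "\<delta>\<^sup>2 \<le> (sin (pi * \<delta> / 2))\<^sup>2" using s2 \<delta>0 by (intro power_mono) auto
  ultimately have c1: "2 * \<delta>\<^sup>2 \<le> 1 - cos (pi * \<delta>)" by simp
  have "0 \<le> pi * \<delta>" "pi * \<delta> \<le> pi / 2" using \<delta>(2) \<delta>0 by (simp_all add: field_simps)
  then have "0 \<le> cos (pi * \<delta>)" by (intro cos_ge_zero) linarith+
  then have "(1 + cos (pi * \<delta>))\<^sup>2 \<le> 2\<^sup>2" by (intro power_mono) auto
  also have "2\<^sup>2 < 8 * (T * \<delta> ^ 5)"
  proof -
    have "\<delta> ^ 5 = T powr (- 5 / 6)" using T by (simp add: \<delta> powr_power)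
    also have "T * \<dots> = T powr (1 / 6)"
      using T powr_add[of T 1 "- 5 / 6"] by simp
    also have "1 \<le> T powr (1 / 6)" using T by (intro ge_one_powr_ge_zero) auto
    finally show ?thesis by simp
  qed
  also have "8 * (T * \<delta> ^ 5) = T * (2 * \<delta> * (2 * \<delta>\<^sup>2)\<^sup>2)"
    by (simp add: power2_eq_square eval_nat_numeral)
  also have "\<dots> \<le> T * (sin (pi * \<delta>) * (1 - cos (pi * \<delta>))\<^sup>2)"
    using s1 c1 T \<delta>0 by (intro mult_left_mono mult_mono power_mono) auto
  finally show ?thesis unfolding S C .
qed

theorem theorem3p2:
  shows "\<exists>c5 c6 c :: real. 0 < c5 \<and> 0 < c6 \<and> 0 < c \<and>
    (\<forall>\<epsilon>::real. 0 < \<epsilon> \<and> \<epsilon> \<le> 1 \<longrightarrow>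
      (\<exists>(w :: real \<Rightarrow> real) (\<phi> :: nat \<Rightarrow> complex poly) (k :: nat \<Rightarrow> nat).
        weight w \<and>
        (AE \<theta> in circle_measure. 1 \<le> w \<theta> \<and> w \<theta> \<le> 1 + \<epsilon>) \<and>
        orthonormal_polynomials w \<phi> \<and>
        strict_mono k \<and> (\<forall>n. 1 \<le> k n) \<and>
        (\<forall>n. ereal (c * real (k n) powr (c5 * \<epsilon>))
               \<le> Linf_norm_circle (poly (\<phi> (k n)))))) \<and>
    (\<forall>T::real. 2 \<le> T \<longrightarrow>
      (\<exists>(w :: real \<Rightarrow> real) (\<phi> :: nat \<Rightarrow> complex poly) (k :: nat \<Rightarrow> nat).
        weight w \<and>
        (AE \<theta> in circle_measure. 1 \<le> w \<theta> \<and> w \<theta> \<le> T) \<and>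
        orthonormal_polynomials w \<phi> \<and>
        strict_mono k \<and> (\<forall>n. 1 \<le> k n) \<and>
        (\<forall>n. ereal (c * real (k n) powr (1 / 2 - c6 * T powr (- 1 / 6)))
               \<le> Linf_norm_circle (poly (\<phi> (k n))))))"
proof -
  \<comment> \<open>The block exponent is \<epsilon>/40; half of it is kept as the guaranteed
    exponent, whence c5 = 1/80.\<close>
  have small: "\<exists>w \<phi> (k :: nat \<Rightarrow> nat). bounded_weight (1 + \<epsilon>) w \<and> orthonormal_polynomials w \<phi> \<and> strict_mono k \<and> (\<forall>i. 1 \<le> k i) \<and>
     (\<forall>i. real (k i) powr (1 / 80 * \<epsilon>) \<le> cmod (poly (\<phi> (k i)) 1))" if "0 < \<epsilon> \<and> \<epsilon> \<le> 1" for \<epsilon> :: real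
    using that growth_parameters_small[of \<epsilon> "\<epsilon> / 40"]
    by (intro bounded_weight_growth[of _ "\<epsilon> / 40"]) auto
  \<comment> \<open>With \<delta> = T^(-1/6), the block exponent is 1/2 - \<delta> and the
    guaranteed one 1/2 - 2 \<delta>, whence c6 = 2. Positivity of the latter requires \<delta> <
    1/4.\<close>
  have large: "\<exists>w \<phi> (k :: nat \<Rightarrow> nat). bounded_weight T w \<and> orthonormal_polynomials w \<phi> \<and> strict_mono k \<and> (\<forall>i. 1 \<le> k i) \<and>
     (\<forall>i. real (k i) powr (1 / 2 - 2 * T powr (- 1 / 6)) \<le> cmod (poly (\<phi> (k i)) 1))" if T: "2 \<le> T" for T :: real
  proof (cases "T powr (- 1 / 6) < 1 / 4")
    case True
    then show ?thesis
      using T growth_parameters_large[OF T refl True]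
      by (intro bounded_weight_growth[of _ "1 / 2 - T powr (- 1 / 6)"]) auto
  next
    case False
    \<comment> \<open>For \<delta> at least 1/4 the required exponent is not positive, so the weight
      of the first part with \<epsilon> = 1, bounded by 2, is more than enough.\<close>
    obtain w \<phi> and k :: "nat \<Rightarrow> nat" where w: "bounded_weight 2 w" "orthonormal_polynomials w \<phi>" "strict_mono k" "\<And>i. 1 \<le> k i"
      "\<And>i. real (k i) powr (1 / 80) \<le> cmod (poly (\<phi> (k i)) 1)"
      using small[of 1] by auto
    have "bounded_weight T w" using w(1) T by (auto simp: bounded_weight_def)
    moreover have "real (k i) powr (1 / 2 - 2 * T powr (- 1 / 6)) \<le> cmod (poly (\<phi> (k i)) 1)" for i
      using powr_mono[of "1 / 2 - 2 * T powr (- 1 / 6)" "1 / 80" "real (k i)"] False w(4,5)[of i] by simp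
    ultimately show ?thesis using w by blast
  qed
  have AE: "AE \<theta> in circle_measure. 1 \<le> w \<theta> \<and> w \<theta> \<le> T" if "bounded_weight T w" for T w
    using bounded_weightD[OF that] by (intro AE_I2) simp
  have Linf: "ereal (1 * a) \<le> Linf_norm_circle (poly p)" if "a \<le> cmod (poly p 1)" for a p
    using that Linf_norm_circle_ge[of p] by (metis ereal_less_eq(3) mult_1 order_trans)
  show ?thesis
  proof (rule exI[of _ "1 / 80"], rule exI[of _ 2], rule exI[of _ 1], intro conjI allI impI)
    fix \<epsilon> :: real assume "0 < \<epsilon> \<and> \<epsilon> \<le> 1"
    from small[OF this] obtain w \<phi> and k :: "nat \<Rightarrow> nat" where "bounded_weight (1 + \<epsilon>) w" "orthonormal_polynomials w \<phi>"
      "strict_mono k" "\<forall>i. 1 \<le> k i" "\<forall>i. real (k i) powr (1 / 80 * \<epsilon>) \<le> cmod (poly (\<phi> (k i)) 1)" by blast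
    then show "\<exists>w \<phi> (k :: nat \<Rightarrow> nat). weight w \<and> (AE \<theta> in circle_measure. 1 \<le> w \<theta> \<and> w \<theta> \<le> 1 + \<epsilon>) \<and>
        orthonormal_polynomials w \<phi> \<and> strict_mono k \<and> (\<forall>n. 1 \<le> k n) \<and>
        (\<forall>n. ereal (1 * real (k n) powr (1 / 80 * \<epsilon>)) \<le> Linf_norm_circle (poly (\<phi> (k n))))"
      using AE Linf bounded_weight_imp_weight by blast
  next
    fix T :: real assume "2 \<le> T"
    from large[OF this] obtain w \<phi> and k :: "nat \<Rightarrow> nat" where "bounded_weight T w" "orthonormal_polynomials w \<phi>"
      "strict_mono k" "\<forall>i. 1 \<le> k i"
      "\<forall>i. real (k i) powr (1 / 2 - 2 * T powr (- 1 / 6)) \<le> cmod (poly (\<phi> (k i)) 1)" by blast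
    then show "\<exists>w \<phi> (k :: nat \<Rightarrow> nat). weight w \<and> (AE \<theta> in circle_measure. 1 \<le> w \<theta> \<and> w \<theta> \<le> T) \<and>
        orthonormal_polynomials w \<phi> \<and> strict_mono k \<and> (\<forall>n. 1 \<le> k n) \<and>
        (\<forall>n. ereal (1 * real (k n) powr (1 / 2 - 2 * T powr (- 1 / 6))) \<le> Linf_norm_circle (poly (\<phi> (k n))))"
      using AE Linf bounded_weight_imp_weight by blast
  qed simp_all
qed

end
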